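(* Given $v:\mathcal X\to\mathbb R$, the map $t\mapsto f_\lambda(t):=\mathbb E_{\pi_\lambda}[v(X^\lambda_t)]$ is $T$-periodic in time. Moreover, for any $k\in\mathbb Z$ it holds $$\partial_{\lambda=0}c_k(f_\lambda)=\int_0^\infty ds\,\langle e^{s(\mathcal L+ik\omega)}v,\hat\psi_k\rangle=\int_0^\infty ds\,e^{-ik\omega s}\,\mathbb E_\pi[v(X_s)\hat\psi_k(X_0)].$$
   Context: $\mathcal X$ is a finite set and $(X_s)_{s\ge0}$ is the (unperturbed) continuous-time Markov jump process on $\mathcal X$ with transition rates $r(x,y)\ge0$ ($r(x,x)=0$), assumed irreducible; $\pi$ is its unique invariant distribution. $T\in(0,+\infty)$, $\omega:=2\pi/T$ (here $\pi$ is the number), and $g:\mathbb R\times\mathcal X\times\mathcal X\to\mathbb R$ is bounded, measurable and $T$-periodic in its first (time) variable. For $\lambda\in\mathbb R$ the perturbed process $(X^\lambda_s)_{s\ge0}$ is the time-inhomogeneous Markov jump process on $\mathcal X$ with transition rates at time $s$ given by $r^\lambda_s(x,y)=e^{\lambda g(s,x,y)}r(x,y)$. The discrete-time chain $(X^\lambda_{nT})_{n\ge0}$ is irreducible and $\pi_\lambda$ denotes its unique invariant distribution; the law of $X^\lambda$ started from $\pi_\lambda$ is the oscillatory steady state. $\mathbb E_{\pi_\lambda}$, $\mathbb E_\pi$ are expectations for initial distribution $\pi_\lambda$, respectively $\pi$. $L^2(\pi)$ is the complex Hilbert space of functions on $\mathcal X$ with $\langle f,h\rangle=\sum_x\pi(x)\overline{f(x)}h(x)$,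 and $\mathcal Lf(x)=\sum_yr(x,y)[f(y)-f(x)]$ is the generator of the unperturbed process. $r^*(x,y):=\pi(y)r(y,x)/\pi(x)$ and $$\psi_s(x):=\sum_{y\in\mathcal X}\big(r^*(x,y)g(s,y,x)-r(x,y)g(s,x,y)\big),\qquad s\in\mathbb R .$$ For a $T$-periodic integrable function $f$ and $k\in\mathbb Z$, $c_k(f):=\frac1T\int_0^Te^{-ik\omega t}f(t)\,dt$ is its $k$-th Fourier coefficient; $\hat\psi_k(x):=\frac1T\int_0^Te^{-ik\omega t}\psi_t(x)\,dt$. $\partial_{\lambda=0}$ is the derivative in $\lambda$ at $\lambda=0$. *)

theory Defs
  imports "HOL-Probability.Probability"
begin

section \<open>Rates and transition functions\<close>

text \<open>The state space is a finite type. A time-independent rate is \<open>r x y\<close>, a time-dependent one is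
  \<open>R s x y\<close>, and the transition probability from \<open>x\<close> at time \<open>s\<close> to \<open>y\<close> at time \<open>t\<close> is \<open>p s t x y\<close>.\<close>

definition irreducible_rates :: "('a \<Rightarrow> 'a \<Rightarrow> real) \<Rightarrow> bool" where
  "irreducible_rates r \<longleftrightarrow> (\<forall>x y. (x, y) \<in> {(u, w). r u w > 0}\<^sup>*)"

text \<open>Since the rates are only measurable in time, the Kolmogorov forward equation
  \<open>\<partial>\<^sub>t p s t = p s t L\<^sub>t\<close> is imposed in integrated form. The condition \<open>has_integral\<close> includes the
  existence of the integral. As \<open>p\<close> takes values in \<open>[0, 1]\<close>, for bounded measurable rates this is the
  Lebesgue integral.\<close>

definition transition_function ::
    "(real \<Rightarrow> 'a \<Rightarrow> 'a \<Rightarrow> real) \<Rightarrow> (real \<Rightarrow> real \<Rightarrow> 'a::finite \<Rightarrow> 'a \<Rightarrow> real) \<Rightarrow> bool" where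
  "transition_function R p \<longleftrightarrow>
     (\<forall>s t x. 0 \<le> s \<and> s \<le> t \<longrightarrow> (\<forall>y. 0 \<le> p s t x y) \<and> (\<Sum>y\<in>UNIV. p s t x y) = 1) \<and>
     (\<forall>s u t x y. 0 \<le> s \<and> s \<le> u \<and> u \<le> t \<longrightarrow>
        p s t x y = (\<Sum>z\<in>UNIV. p s u x z * p u t z y)) \<and>
     (\<forall>s t x y. 0 \<le> s \<and> s \<le> t \<longrightarrow>
        ((\<lambda>u. (\<Sum>z\<in>UNIV. p s u x z * R u z y) - p s u x y * (\<Sum>z\<in>UNIV. R u y z))
           has_integral (p s t x y - of_bool (x = y))) {s..t})"

definition invariant_distribution :: "('a::finite \<Rightarrow> 'a \<Rightarrow> real) \<Rightarrow> ('a \<Rightarrow> real) \<Rightarrow> bool" where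
  "invariant_distribution K \<mu> \<longleftrightarrow>
     (\<forall>x. 0 \<le> \<mu> x) \<and> (\<Sum>x\<in>UNIV. \<mu> x) = 1 \<and> (\<forall>y. (\<Sum>x\<in>UNIV. \<mu> x * K x y) = \<mu> y)"

section \<open>Markov jump processes\<close>

text \<open>The Markov property is expressed by the finite-dimensional distributions. The two path
  conditions say that almost every path is right-continuous and piecewise constant, with finitely
  many jumps in each bounded time interval.\<close>

definition markov_jump_process ::
    "'w measure \<Rightarrow> (real \<Rightarrow> 'w \<Rightarrow> 'a) \<Rightarrow> ('a \<Rightarrow> real) \<Rightarrow>
     (real \<Rightarrow> real \<Rightarrow> 'a::finite \<Rightarrow> 'a \<Rightarrow> real) \<Rightarrow> bool" where
  "markov_jump_process M X \<mu> p \<longleftrightarrow>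
     prob_space M \<and>
     (\<forall>t\<ge>0. X t \<in> measurable M (count_space UNIV)) \<and>
     (AE w in M. \<forall>t\<ge>0. \<exists>\<delta>>0. \<forall>u\<in>{t..<t + \<delta>}. X u w = X t w) \<and>
     (AE w in M. \<forall>t>0. \<exists>\<delta>>0. \<exists>x. \<forall>u\<in>{t - \<delta><..<t}. 0 \<le> u \<longrightarrow> X u w = x) \<and>
     (\<forall>(n::nat) (t::nat \<Rightarrow> real) (x::nat \<Rightarrow> 'a).
        t 0 = 0 \<and> (\<forall>i<n. t i \<le> t (Suc i)) \<longrightarrow>
        measure M {w \<in> space M. \<forall>i\<le>n. X (t i) w = x i} =
          \<mu> (x 0) * (\<Prod>i<n. p (t i) (t (Suc i)) (x i) (x (Suc i))))"

section \<open>Perturbation and response\<close>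

definition perturbed_rate ::
    "(real \<Rightarrow> 'a \<Rightarrow> 'a \<Rightarrow> real) \<Rightarrow> ('a \<Rightarrow> 'a \<Rightarrow> real) \<Rightarrow> real \<Rightarrow> real \<Rightarrow> 'a \<Rightarrow> 'a \<Rightarrow> real" where
  "perturbed_rate g r l s x y = exp (l * g s x y) * r x y"

definition reversed_rate :: "('a \<Rightarrow> real) \<Rightarrow> ('a \<Rightarrow> 'a \<Rightarrow> real) \<Rightarrow> 'a \<Rightarrow> 'a \<Rightarrow> real" where
  "reversed_rate \<pi> r x y = \<pi> y * r y x / \<pi> x"

definition psi ::
    "('a::finite \<Rightarrow> real) \<Rightarrow> ('a \<Rightarrow> 'a \<Rightarrow> real) \<Rightarrow> (real \<Rightarrow> 'a \<Rightarrow> 'a \<Rightarrow> real) \<Rightarrow> real \<Rightarrow> 'a \<Rightarrow> real" where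
  "psi \<pi> r g s x = (\<Sum>y\<in>UNIV. reversed_rate \<pi> r x y * g s y x - r x y * g s x y)"

definition fourier_coeff :: "real \<Rightarrow> int \<Rightarrow> (real \<Rightarrow> complex) \<Rightarrow> complex" where
  "fourier_coeff T k f =
     1 / of_real T * (LBINT t:{0..T}. exp (- \<i> * of_int k * of_real (2 * pi / T) * of_real t) * f t)"

definition psi_hat ::
    "('a::finite \<Rightarrow> real) \<Rightarrow> ('a \<Rightarrow> 'a \<Rightarrow> real) \<Rightarrow> (real \<Rightarrow> 'a \<Rightarrow> 'a \<Rightarrow> real) \<Rightarrow> real \<Rightarrow> int \<Rightarrow> 'a \<Rightarrow> complex"
  where "psi_hat \<pi> r g T k x = fourier_coeff T k (\<lambda>t. of_real (psi \<pi> r g t x))"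

definition inner_L2 :: "('a::finite \<Rightarrow> real) \<Rightarrow> ('a \<Rightarrow> complex) \<Rightarrow> ('a \<Rightarrow> complex) \<Rightarrow> complex" where
  "inner_L2 \<pi> f h = (\<Sum>x\<in>UNIV. of_real (\<pi> x) * cnj (f x) * h x)"

definition generator :: "('a::finite \<Rightarrow> 'a \<Rightarrow> real) \<Rightarrow> ('a \<Rightarrow> complex) \<Rightarrow> 'a \<Rightarrow> complex" where
  "generator r f x = (\<Sum>y\<in>UNIV. of_real (r x y) * (f y - f x))"

text \<open>The operator exponential series. It is summed pointwise, which on a finite state space is the
  same as convergence in operator norm for linear \<open>A\<close>.\<close>

definition op_exp :: "(('a \<Rightarrow> complex) \<Rightarrow> 'a \<Rightarrow> complex) \<Rightarrow> ('a \<Rightarrow> complex) \<Rightarrow> 'a \<Rightarrow> complex" where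
  "op_exp A f x = (\<Sum>n. (A ^^ n) f x / fact n)"

end

theory Submission
  imports Defs
begin

text \<open>
  Put \<open>c = - \<i>k\<omega>\<close>, let \<open>f\<close> be \<open>v\<close> minus its mean under \<open>\<pi>\<close>, and let \<open>H = \<integral>\<^sub>0\<^sup>\<infinity> e\<^sup>s\<^sup>(\<^sup>L\<^sup>+\<^sup>c\<^sup>) f ds\<close>, which
  converges by exponential ergodicity and solves the Poisson equation \<open>(L + c) H = - f\<close>. If \<open>\<mu>\<^sub>t\<close> is the
  oscillatory steady state for \<open>\<lambda>\<close>, with generators \<open>L\<^sup>\<lambda>\<^sub>t\<close>, then \<open>t \<mapsto> exp (c t) \<mu>\<^sub>t(H)\<close> is \<open>T\<close>-periodic, so its
  derivative integrates to \<open>0\<close> over a period. With the Poisson equation this says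
  \<open>\<integral>\<^sub>0\<^sup>T exp (c t) \<mu>\<^sub>t(f) dt = \<integral>\<^sub>0\<^sup>T exp (c t) \<mu>\<^sub>t((L\<^sup>\<lambda>\<^sub>t - L) H) dt\<close>. The right-hand side carries an explicit
  factor \<open>\<lambda>\<close>, so only the convergence of \<open>\<mu>\<^sub>t\<close> to \<open>\<pi>\<close>, uniformly in \<open>t\<close>, is needed to differentiate at
  \<open>\<lambda> = 0\<close>; no expansion of the steady state itself is required. The limit is a pairing of \<open>H\<close> with \<open>\<psi>\<close> by
  duality between the forward and the backward generator.
\<close>

section \<open>Indefinite integrals of bounded functions\<close>

text \<open>The sign of \<open>c\<close> comes from the inner product, which conjugates its first
  argument: for real \<open>v\<close> the conjugate of the exponential of
  \<open>s (L + \<i>k\<omega>)\<close> applied to \<open>v\<close> is the one with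
  \<open>L - \<i>k\<omega>\<close>, and \<open>exp (c t)\<close> is then exactly the Fourier weight.
  Centring is forced: the semigroup does not damp constants, so for \<open>v\<close> with nonzero
  mean the integral defining \<open>H\<close> would not converge absolutely, and for
  \<open>k = 0\<close> the operator \<open>L + c\<close> is singular. Centring is also harmless:
  \<open>psi_hat\<close> has \<pi>-mean zero, and the removed constant contributes the same Fourier
  coefficient for every \<lambda>. The convergence of the steady state to \<pi> is obtained
  dynamically. Periodicity allows the marginal at \<open>t\<close> to be read many periods later,
  when the unperturbed semigroup has forgotten its initial law, and only a comparison of the two
  dynamics over that fixed horizon remains.\<close>

text \<open>The rates are only measurable in time, so transition probabilities need not be differentiable at
  any given time. Derivatives are therefore replaced by bounded integrands of indefinite integrals.\<close>

definition prim_on :: "(real \<Rightarrow> 'b::euclidean_space) \<Rightarrow> (real \<Rightarrow> 'b) \<Rightarrow> real \<Rightarrow> real \<Rightarrow> bool" where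
  "prim_on F f a b \<longleftrightarrow> bounded (f ` {a..b}) \<and>
     (\<forall>s t. a \<le> s \<and> s \<le> t \<and> t \<le> b \<longrightarrow> (f has_integral (F t - F s)) {s..t})"

lemma prim_onD:
  "prim_on F f a b \<Longrightarrow> a \<le> s \<Longrightarrow> s \<le> t \<Longrightarrow> t \<le> b \<Longrightarrow> (f has_integral (F t - F s)) {s..t}"
  by (simp add: prim_on_def)

text \<open>Additivity over adjacent intervals recovers all subintervals from those that start at
  \<open>a\<close>, which is what the forward equation from time 0 supplies.\<close>

lemma prim_onI:
  fixes F f :: "real \<Rightarrow> 'b::euclidean_space"
  assumes "bounded (f ` {a..b})"
    and int: "\<And>t. a \<le> t \<Longrightarrow> t \<le> b \<Longrightarrow> (f has_integral (F t - F a)) {a..t}"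
  shows "prim_on F f a b"
  unfolding prim_on_def
proof (intro conjI allI impI, fact)
  fix s t assume st: "a \<le> s \<and> s \<le> t \<and> t \<le> b"
  have "f integrable_on {s..t}"
    using int[of t] st by (meson has_integral_integrable integrable_subinterval_real atLeastatMost_subset_iff order_trans order_refl)
  then obtain i where i: "(f has_integral i) {s..t}" by blast
  have "(f has_integral (F s - F a + i)) {a..t}"
    by (rule has_integral_combine[of a s t]) (use st i int in auto)
  moreover have "(f has_integral (F t - F a)) {a..t}" using int st by auto
  ultimately have "F s - F a + i = F t - F a" by (rule has_integral_unique)
  then have "i = F t - F s" by (simp add: algebra_simps)
  then show "(f has_integral (F t - F s)) {s..t}" using i by simp
qed

lemma prim_on_lipschitz:
  assumes "prim_on F f a b"
  shows "\<exists>K>0. (\<forall>s t. a \<le> s \<longrightarrow> s \<le> t \<longrightarrow> t \<le> b \<longrightarrow> norm (F t - F s) \<le> K * (t - s)) \<and>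
    (\<forall>t\<in>{a..b}. norm (f t) \<le> K)"
proof -
  obtain K where K: "0 < K" "\<And>t. t \<in> {a..b} \<Longrightarrow> norm (f t) \<le> K"
    using assms unfolding prim_on_def bounded_pos by auto
  have "norm (F t - F s) \<le> K * (t - s)" if st: "a \<le> s" "s \<le> t" "t \<le> b" for s t
  proof -
    have "norm (F t - F s) \<le> K * measure lborel (cbox s t)"
    proof (rule has_integral_bound)
      show "(f has_integral (F t - F s)) (cbox s t)" using prim_onD[OF assms st] by simp
      show "norm (f x) \<le> K" if "x \<in> cbox s t" for x
        by (rule K(2)) (use that st in simp)
    qed (use K(1) in simp)
    then show "norm (F t - F s) \<le> K * (t - s)" using st by simp
  qed
  then show ?thesis using K by blast
qed

lemma prim_on_continuous:
  assumes "prim_on F f a b"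
  shows "continuous_on {a..b} F"
proof -
  obtain K where K: "0 < K" "\<And>s t. a \<le> s \<Longrightarrow> s \<le> t \<Longrightarrow> t \<le> b \<Longrightarrow> norm (F t - F s) \<le> K * (t - s)"
    using prim_on_lipschitz[OF assms] by blast
  have "K-lipschitz_on {a..b} F"
  proof (rule lipschitz_onI)
    fix x y assume "x \<in> {a..b}" "y \<in> {a..b}"
    then show "dist (F x) (F y) \<le> K * dist x y"
      using K(2)[of x y] K(2)[of y x]
      by (cases "x \<le> y") (auto simp: dist_norm norm_minus_commute abs_if)
  qed (use K in auto)
  then show ?thesis by (rule lipschitz_on_continuous_on)
qed

lemma prim_on_bounded: "prim_on F f a b \<Longrightarrow> bounded (F ` {a..b})"
  by (meson compact_Icc compact_continuous_image compact_imp_bounded prim_on_continuous)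

lemma prim_on_sum:
  assumes "finite I" "\<And>i. i \<in> I \<Longrightarrow> prim_on (F i) (f i) a b"
  shows "prim_on (\<lambda>t. \<Sum>i\<in>I. F i t) (\<lambda>t. \<Sum>i\<in>I. f i t) a b"
proof -
  have "bounded ((\<lambda>t. \<Sum>i\<in>I. f i t) ` {a..b})"
  proof -
    have "\<forall>i\<in>I. \<exists>K. \<forall>t\<in>{a..b}. norm (f i t) \<le> K"
      using assms(2) by (auto simp: prim_on_def bounded_iff)
    then obtain K where K: "\<And>i t. i \<in> I \<Longrightarrow> t \<in> {a..b} \<Longrightarrow> norm (f i t) \<le> K i" by metis
    show ?thesis
      unfolding bounded_iff
      by (rule exI[of _ "sum K I"]) (auto intro!: order_trans[OF norm_sum] sum_mono K)
  qed
  moreover have "((\<lambda>t. \<Sum>i\<in>I. f i t) has_integral ((\<Sum>i\<in>I. F i t) - (\<Sum>i\<in>I. F i s))) {s..t}"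
    if "a \<le> s" "s \<le> t" "t \<le> b" for s t
    unfolding sum_subtractf[symmetric]
    by (rule has_integral_sum) (use assms that in \<open>auto intro: prim_onD\<close>)
  ultimately show ?thesis by (auto simp: prim_on_def)
qed

lemma prim_on_linear:
  assumes "prim_on F f a b" "bounded_linear L"
  shows "prim_on (\<lambda>t. L (F t)) (\<lambda>t. L (f t)) a b"
  unfolding prim_on_def
proof (intro conjI allI impI)
  have "bounded (L ` f ` {a..b})"
    using assms by (auto simp: prim_on_def intro: bounded_linear_image)
  then show "bounded ((\<lambda>t. L (f t)) ` {a..b})" by (simp add: image_image)
  fix s t assume "a \<le> s \<and> s \<le> t \<and> t \<le> b"
  then have "(f has_integral (F t - F s)) {s..t}" using assms by (auto intro: prim_onD)
  from has_integral_linear[OF this assms(2)]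
  show "((\<lambda>t. L (f t)) has_integral L (F t) - L (F s)) {s..t}"
    by (simp add: o_def linear_diff[OF bounded_linear.linear[OF assms(2)]])
qed

lemma prim_on_vector_derivative:
  assumes "\<And>t. a \<le> t \<Longrightarrow> t \<le> b \<Longrightarrow> (F has_vector_derivative f t) (at t within {a..b})"
    and "continuous_on {a..b} f"
  shows "prim_on F f a b"
  unfolding prim_on_def
proof (intro conjI allI impI)
  show "bounded (f ` {a..b})"
    by (simp add: assms compact_continuous_image compact_imp_bounded)
  fix s t assume st: "a \<le> s \<and> s \<le> t \<and> t \<le> b"
  show "(f has_integral F t - F s) {s..t}"
    by (rule fundamental_theorem_of_calculus)
      (use st in \<open>auto intro!: has_vector_derivative_within_subset[OF assms(1)]\<close>)
qed

text \<open>Dividing by \<open>t - s\<close> shows that the derivative vanishes at every point. This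
  replaces almost-everywhere differentiation in the product rule.\<close>

lemma quadratic_increment_imp_constant:
  fixes D :: "real \<Rightarrow> 'b::real_normed_vector"
  assumes D: "\<And>s t. a \<le> s \<Longrightarrow> s \<le> t \<Longrightarrow> t \<le> b \<Longrightarrow> norm (D t - D s) \<le> K * (t - s)\<^sup>2"
    and x: "x \<in> {a..b}"
  shows "D x = D a"
proof (rule has_derivative_zero_unique[of "{a..b}"])
  have K: "norm (D t - D s) \<le> K * (t - s)\<^sup>2" if "s \<in> {a..b}" "t \<in> {a..b}" for s t
    using D[of s t] D[of t s] that
    by (cases "s \<le> t") (auto simp: norm_minus_commute power2_commute)
  fix y assume y: "y \<in> {a..b}"
  show "(D has_derivative (\<lambda>h. 0)) (at y within {a..b})"
  proof (rule has_derivativeI_sandwich[of 1])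
    fix z assume z: "z \<in> {a..b}" "z \<noteq> y" "dist z y < 1"
    then show "norm (D z - D y - 0) / norm (z - y) \<le> \<bar>K\<bar> * \<bar>z - y\<bar>"
    proof -
      have "norm (D z - D y) \<le> K * (z - y)\<^sup>2" using K y z by auto
      also have "\<dots> \<le> \<bar>K\<bar> * (z - y)\<^sup>2" by (simp add: mult_right_mono)
      finally show ?thesis using z by (simp add: field_simps power2_eq_square)
    qed
  next
    have "((\<lambda>z. \<bar>K\<bar> * \<bar>z - y\<bar>) \<longlongrightarrow> \<bar>K\<bar> * \<bar>y - y\<bar>) (at y within {a..b})"
      by (intro tendsto_intros)
    then show "((\<lambda>z. \<bar>K\<bar> * \<bar>z - y\<bar>) \<longlongrightarrow> 0) (at y within {a..b})" by simp
  qed auto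
qed (use x in auto)

text \<open>Gauge integrability alone is not stable under products. Boundedness upgrades
  \<open>f\<close> to absolute integrability, and a continuous factor on a compact interval is
  bounded and measurable. Both orders are needed because the algebra need not commute.\<close>

lemma prim_on_integrable_mult:
  fixes f G :: "real \<Rightarrow> 'b::{euclidean_space, real_normed_algebra}"
  assumes f: "f integrable_on {a..b}" "bounded (f ` {a..b})" and G: "continuous_on {a..b} G"
  shows "(\<lambda>t. f t * G t) integrable_on {a..b}" "(\<lambda>t. G t * f t) integrable_on {a..b}"
proof -
  obtain K where K: "\<And>t. t \<in> {a..b} \<Longrightarrow> norm (f t) \<le> K" using f unfolding bounded_iff by blast
  have af: "f absolutely_integrable_on {a..b}"
    by (rule absolutely_integrable_integrable_bound[of _ _ "\<lambda>_. K"]) (use K f in auto)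
  have bG: "bounded (G ` {a..b})" using G by (simp add: compact_continuous_image compact_imp_bounded)
  have mG: "G \<in> borel_measurable (lebesgue_on {a..b})"
    using G by (rule continuous_imp_measurable_on_sets_lebesgue) auto
  have bil: "bilinear (\<lambda>x y. y * x :: 'b)" "bilinear (\<lambda>x y. x * y :: 'b)"
    by (auto simp: bilinear_def linear_iff algebra_simps)
  have "(\<lambda>t. f t * G t) absolutely_integrable_on {a..b}"
    by (rule absolutely_integrable_bounded_measurable_product[OF bil(1) mG _ bG af]) auto
  moreover have "(\<lambda>t. G t * f t) absolutely_integrable_on {a..b}"
    by (rule absolutely_integrable_bounded_measurable_product[OF bil(2) mG _ bG af]) auto
  ultimately show "(\<lambda>t. f t * G t) integrable_on {a..b}" "(\<lambda>t. G t * f t) integrable_on {a..b}"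
    by (auto intro: set_lebesgue_integral_eq_integral)
qed

text \<open>No differentiability is available, so the product rule is derived by showing that the defect
  \<open>F t * G t - integral {a..t} (f * G + F * g)\<close> has increments of quadratic order.\<close>

lemma prim_on_mult:
  fixes F G f g :: "real \<Rightarrow> 'b::{euclidean_space, real_normed_algebra}"
  assumes F: "prim_on F f a b" and G: "prim_on G g a b"
  shows "prim_on (\<lambda>t. F t * G t) (\<lambda>t. f t * G t + F t * g t) a b"
proof (cases "a \<le> b")
  case ab: True
  obtain K where K: "0 < K" "\<And>s t. a \<le> s \<Longrightarrow> s \<le> t \<Longrightarrow> t \<le> b \<Longrightarrow> norm (F t - F s) \<le> K * (t - s)"
    "\<And>t. t \<in> {a..b} \<Longrightarrow> norm (f t) \<le> K"
    using prim_on_lipschitz[OF F] by blast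
  obtain M where M: "0 < M" "\<And>s t. a \<le> s \<Longrightarrow> s \<le> t \<Longrightarrow> t \<le> b \<Longrightarrow> norm (G t - G s) \<le> M * (t - s)"
    "\<And>t. t \<in> {a..b} \<Longrightarrow> norm (g t) \<le> M"
    using prim_on_lipschitz[OF G] by blast
  obtain KF where KF: "\<And>t. t \<in> {a..b} \<Longrightarrow> norm (F t) \<le> KF"
    using prim_on_bounded[OF F] unfolding bounded_iff by blast
  obtain KG where KG: "\<And>t. t \<in> {a..b} \<Longrightarrow> norm (G t) \<le> KG"
    using prim_on_bounded[OF G] unfolding bounded_iff by blast
  let ?i = "\<lambda>t. f t * G t + F t * g t"
  have "f integrable_on {a..b}" "g integrable_on {a..b}"
    using prim_onD[OF F, of a b] prim_onD[OF G, of a b] ab by blast+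
  moreover have "bounded (f ` {a..b})" "bounded (g ` {a..b})"
    using F G by (auto simp: prim_on_def)
  ultimately have int: "?i integrable_on {a..b}"
    by (intro integrable_add prim_on_integrable_mult prim_on_continuous[OF F] prim_on_continuous[OF G])
  define D where "D t = F t * G t - integral {a..t} ?i" for t
  have D_const: "D t = D a" if "t \<in> {a..b}" for t
  proof (rule quadratic_increment_imp_constant[OF _ that])
    fix s t assume st: "a \<le> s" "s \<le> t" "t \<le> b"
    have sub: "?i integrable_on {u..w}" if "a \<le> u" "w \<le> b" for u w
      by (rule integrable_subinterval_real[OF int]) (use that in auto)
    have c: "integral {a..s} ?i + integral {s..t} ?i = integral {a..t} ?i"
      by (rule Henstock_Kurzweil_Integration.integral_combine) (use st sub in auto)
    have 1: "(?i has_integral integral {s..t} ?i) {s..t}"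
      using sub st by (auto intro: integrable_integral)
    \<comment> \<open>\<open>G\<close> is frozen at the right end and \<open>F\<close> at the left
      end, because \<open>(F t - F s) * G t + F s * (G t - G s)\<close> telescopes exactly to the
      increment of \<open>F * G\<close>.\<close>
    have 2: "((\<lambda>u. f u * G t) has_integral (F t - F s) * G t) {s..t}"
      using has_integral_mult_left[OF prim_onD[OF F st], of "G t"] .
    have 3: "((\<lambda>u. F s * g u) has_integral F s * (G t - G s)) {s..t}"
      using has_integral_mult_right[OF prim_onD[OF G st], of "F s"] .
    have "((\<lambda>u. f u * G t + F s * g u - ?i u) has_integral
        ((F t - F s) * G t + F s * (G t - G s) - integral {s..t} ?i)) {s..t}"
      by (intro has_integral_diff has_integral_add 1 2 3)
    moreover have "(F t - F s) * G t + F s * (G t - G s) - integral {s..t} ?i = D t - D s"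
      unfolding D_def c[symmetric] by (simp add: algebra_simps)
    ultimately have "((\<lambda>u. f u * G t + F s * g u - ?i u) has_integral (D t - D s)) (cbox s t)" by simp
    then have "norm (D t - D s) \<le> (2 * K * M * (t - s)) * measure lborel (cbox s t)"
    proof (rule has_integral_bound[rotated])
      fix u assume "u \<in> cbox s t"
      then have u: "s \<le> u" "u \<le> t" by auto
      \<comment> \<open>The error of freezing is a bounded integrand times a Lipschitz increment,
        hence of order \<open>t - s\<close>; integration over \<open>{s..t}\<close> makes it
        quadratic.\<close>
      have "norm (f u * G t + F s * g u - ?i u) = norm (f u * (G t - G u) - (F u - F s) * g u)"
        by (simp add: algebra_simps)
      also have "\<dots> \<le> norm (f u) * norm (G t - G u) + norm (F u - F s) * norm (g u)"
        by (intro order_trans[OF norm_triangle_ineq4] add_mono norm_mult_ineq)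
      also have "\<dots> \<le> K * (M * (t - u)) + (K * (u - s)) * M"
        using u st K(1) M(1) by (intro add_mono mult_mono K M) auto
      also have "\<dots> \<le> 2 * K * M * (t - s)"
      proof -
        have "K * M * ((t - u) + (u - s)) \<le> K * M * (2 * (t - s))"
          using K(1) M(1) u by (intro mult_left_mono) auto
        then show ?thesis by (simp add: algebra_simps)
      qed
      finally show "norm (f u * G t + F s * g u - ?i u) \<le> 2 * K * M * (t - s)" .
    qed (use K M st in auto)
    also have "\<dots> = 2 * K * M * (t - s)\<^sup>2" using st by (simp add: power2_eq_square)
    finally show "norm (D t - D s) \<le> 2 * K * M * (t - s)\<^sup>2" .
  qed
  show ?thesis
  proof (rule prim_onI)
    show "bounded (?i ` {a..b})"
      unfolding bounded_iff
    proof (rule exI[of _ "K * KG + KF * M"], clarify)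
      fix t assume t: "t \<in> {a..b}"
      have "norm (?i t) \<le> norm (f t) * norm (G t) + norm (F t) * norm (g t)"
        by (intro order_trans[OF norm_triangle_ineq] add_mono norm_mult_ineq)
      also have "\<dots> \<le> K * KG + KF * M"
        using t K M KF[OF t] KG[OF t] by (intro add_mono mult_mono) (auto intro: order_trans[OF norm_ge_zero])
      finally show "norm (?i t) \<le> K * KG + KF * M" .
    qed
    fix t assume t: "a \<le> t" "t \<le> b"
    have "?i integrable_on {a..t}"
      by (rule integrable_subinterval_real[OF int]) (use t in auto)
    then have "(?i has_integral integral {a..t} ?i) {a..t}" by (rule integrable_integral)
    moreover have "integral {a..t} ?i = F t * G t - F a * G a"
      using D_const[of t] t by (simp add: D_def algebra_simps)
    ultimately show "(?i has_integral F t * G t - F a * G a) {a..t}" by simp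
  qed
qed (auto simp: prim_on_def)

lemma prim_on_add:
  assumes "prim_on F f a b" "prim_on G g a b"
  shows "prim_on (\<lambda>t. F t + G t) (\<lambda>t. f t + g t) a b"
  unfolding prim_on_def
proof (intro conjI allI impI)
  show "bounded ((\<lambda>t. f t + g t) ` {a..b})"
    using assms by (auto simp: prim_on_def bounded_plus_comp)
  fix s t assume "a \<le> s \<and> s \<le> t \<and> t \<le> b"
  then have "((\<lambda>t. f t + g t) has_integral (F t - F s) + (G t - G s)) {s..t}"
    by (intro has_integral_add prim_onD[OF assms(1)] prim_onD[OF assms(2)]) auto
  then show "((\<lambda>t. f t + g t) has_integral F t + G t - (F s + G s)) {s..t}"
    by (simp add: algebra_simps)
qed

lemma prim_on_mono:
  fixes F :: "real \<Rightarrow> real"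
  assumes "prim_on F f a b" "a \<le> s" "s \<le> t" "t \<le> b" "\<And>u. s \<le> u \<Longrightarrow> u \<le> t \<Longrightarrow> 0 \<le> f u"
  shows "F s \<le> F t"
  using has_integral_nonneg[OF prim_onD[OF assms(1-4)]] assms(5) by auto

section \<open>Transition functions with bounded rates\<close>

text \<open>Swapping the double sum moves the operator from the measure to the function; diagonal
  terms cancel on both sides. \<open>\<rho>\<close> may be signed, so the identity covers generators
  as well as the first-order perturbation \<open>r * g\<close>.\<close>

lemma forward_backward_duality:
  fixes \<mu> :: "'a::finite \<Rightarrow> real" and h :: "'a \<Rightarrow> complex"
  shows "(\<Sum>y\<in>UNIV. of_real ((\<Sum>z\<in>UNIV. \<mu> z * \<rho> z y) - \<mu> y * (\<Sum>z\<in>UNIV. \<rho> y z)) * h y) =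
    (\<Sum>y\<in>UNIV. of_real (\<mu> y) * generator \<rho> h y)"
proof -
  have "(\<Sum>y\<in>UNIV. of_real ((\<Sum>z\<in>UNIV. \<mu> z * \<rho> z y) - \<mu> y * (\<Sum>z\<in>UNIV. \<rho> y z)) * h y) =
      (\<Sum>y\<in>UNIV. \<Sum>z\<in>UNIV. of_real (\<mu> z * \<rho> z y) * h y) -
      (\<Sum>y\<in>UNIV. \<Sum>z\<in>UNIV. of_real (\<mu> y * \<rho> y z) * h y)"
    by (simp add: left_diff_distrib sum_subtractf sum_distrib_left sum_distrib_right)
  also have "(\<Sum>y\<in>UNIV. \<Sum>z\<in>UNIV. of_real (\<mu> z * \<rho> z y) * h y) =
      (\<Sum>z\<in>UNIV. \<Sum>y\<in>UNIV. of_real (\<mu> z * \<rho> z y) * h y)"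
    by (rule sum.swap)
  also have "\<dots> - (\<Sum>y\<in>UNIV. \<Sum>z\<in>UNIV. of_real (\<mu> y * \<rho> y z) * h y) =
      (\<Sum>y\<in>UNIV. of_real (\<mu> y) * generator \<rho> h y)"
    unfolding generator_def sum_subtractf[symmetric] sum_distrib_left
    by (simp add: algebra_simps)
  finally show ?thesis .
qed

lemma generator_cmult: "generator \<rho> (\<lambda>y. c * f y) x = c * generator \<rho> f x"
  by (simp add: generator_def sum_distrib_left algebra_simps)

lemma generator_const: "generator \<rho> (\<lambda>y. c) x = 0"
  by (simp add: generator_def)

text \<open>Signs of \<open>\<rho>\<close> are free, because the bound is meant for differences of
  rates and for Taylor remainders. The factor 2 comes from \<open>H z - H y\<close>.\<close>

lemma generator_norm_bound:
  fixes H :: "'a::finite \<Rightarrow> complex"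
  assumes "\<And>y z. \<bar>\<rho> y z\<bar> \<le> e" "\<And>x. norm (H x) \<le> B"
  shows "norm (generator \<rho> H y) \<le> real CARD('a) * (e * (2 * B))"
proof -
  have e: "0 \<le> e" using assms(1) by (meson abs_ge_zero order_trans)
  have "norm (generator \<rho> H y) \<le> (\<Sum>z\<in>(UNIV::'a set). e * (2 * B))"
    unfolding generator_def
  proof (rule sum_norm_le)
    fix z
    have "norm (H z - H y) \<le> 2 * B"
      using norm_triangle_ineq4[of "H z" "H y"] assms(2)[of z] assms(2)[of y] by linarith
    then show "norm (of_real (\<rho> y z) * (H z - H y)) \<le> e * (2 * B)"
      unfolding norm_mult norm_of_real by (intro mult_mono assms e) auto
  qed
  then show ?thesis by simp
qed

lemma generator_rate_diff: "generator \<rho> H y - generator \<rho>' H y = generator (\<lambda>x z. \<rho> x z - \<rho>' x z) H y"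
  by (simp add: generator_def left_diff_distrib flip: sum_subtractf)

lemma generator_rate_cmult: "of_real l * generator \<rho> H y = generator (\<lambda>x z. l * \<rho> x z) H y"
  by (simp add: generator_def sum_distrib_left mult.assoc)

lemma transition_functionD:
  assumes "transition_function R p"
  shows transition_nonneg: "\<And>s t x y. 0 \<le> s \<Longrightarrow> s \<le> t \<Longrightarrow> 0 \<le> p s t x y"
    and transition_sum: "\<And>s t x. 0 \<le> s \<Longrightarrow> s \<le> t \<Longrightarrow> (\<Sum>y\<in>UNIV. p s t x y) = 1"
    and chapman_kolmogorov: "\<And>s u t x y. 0 \<le> s \<Longrightarrow> s \<le> u \<Longrightarrow> u \<le> t \<Longrightarrow>
        p s t x y = (\<Sum>z\<in>UNIV. p s u x z * p u t z y)"
    and kolmogorov_forward: "\<And>s t x y. 0 \<le> s \<Longrightarrow> s \<le> t \<Longrightarrow>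
        ((\<lambda>u. (\<Sum>z\<in>UNIV. p s u x z * R u z y) - p s u x y * (\<Sum>z\<in>UNIV. R u y z))
           has_integral (p s t x y - of_bool (x = y))) {s..t}"
proof -
  note D = assms[unfolded transition_function_def]
  show "0 \<le> p s t x y" "(\<Sum>y\<in>UNIV. p s t x y) = 1" if "0 \<le> s" "s \<le> t" for s t x y
    using D[THEN conjunct1, rule_format, OF conjI[OF that]] by auto
  show "p s t x y = (\<Sum>z\<in>UNIV. p s u x z * p u t z y)" if "0 \<le> s" "s \<le> u" "u \<le> t" for s u t x y
    by (rule D[THEN conjunct2, THEN conjunct1, rule_format]) (use that in simp)
  show "((\<lambda>u. (\<Sum>z\<in>UNIV. p s u x z * R u z y) - p s u x y * (\<Sum>z\<in>UNIV. R u y z))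
           has_integral (p s t x y - of_bool (x = y))) {s..t}" if "0 \<le> s" "s \<le> t" for s t x y
    by (rule D[THEN conjunct2, THEN conjunct2, rule_format]) (use that in simp)
qed

lemma transition_function_shift:
  assumes p: "transition_function R p" and a: "0 \<le> a"
  shows "transition_function (\<lambda>s. R (a + s)) (\<lambda>s t. p (a + s) (a + t))"
  unfolding transition_function_def
proof (intro conjI allI impI; (elim conjE)?)
  fix s t :: real and x y
  assume st: "0 \<le> s" "s \<le> t"
  show "0 \<le> p (a + s) (a + t) x y" "(\<Sum>y\<in>UNIV. p (a + s) (a + t) x y) = 1"
    using st a by (simp_all add: transition_nonneg[OF p] transition_sum[OF p])
  let ?f = "\<lambda>u. (\<Sum>z\<in>UNIV. p (a + s) u x z * R u z y) - p (a + s) u x y * (\<Sum>z\<in>UNIV. R u y z)"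
  have "(?f has_integral (p (a + s) (a + t) x y - of_bool (x = y))) (cbox (s + a) (t + a))"
    using kolmogorov_forward[OF p, of "a + s" "a + t" x y] st a by (simp add: add.commute)
  then show "((\<lambda>u. (\<Sum>z\<in>UNIV. p (a + s) (a + u) x z * R (a + u) z y) -
      p (a + s) (a + u) x y * (\<Sum>z\<in>UNIV. R (a + u) y z)) has_integral
      p (a + s) (a + t) x y - of_bool (x = y)) {s..t}"
    unfolding has_integral_shift_cbox_iff[symmetric] by (simp add: o_def)
next
  fix s u t :: real and x y
  assume "0 \<le> s" "s \<le> u" "u \<le> t"
  then show "p (a + s) (a + t) x y = (\<Sum>z\<in>UNIV. p (a + s) (a + u) x z * p (a + u) (a + t) z y)"
    using a by (intro chapman_kolmogorov[OF p]) auto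
qed

text \<open>The integrand of \<open>- exp (- C * t) * N t\<close> is
  \<open>exp (- C * t) * (C * N t - n t)\<close>, which is nonnegative, so this function increases
  from its initial value 0.\<close>

lemma prim_on_gronwall:
  fixes N :: "real \<Rightarrow> real"
  assumes N: "prim_on N n 0 b" and le: "\<And>t. 0 \<le> t \<Longrightarrow> t \<le> b \<Longrightarrow> n t \<le> C * N t"
    and N0: "N 0 = 0" and t: "0 \<le> t" "t \<le> b"
  shows "N t \<le> 0"
proof -
  have "prim_on (\<lambda>t. exp (- C * t)) (\<lambda>t. - C * exp (- C * t)) 0 b"
    by (rule prim_on_vector_derivative)
      (auto intro!: derivative_eq_intros continuous_intros simp flip: has_real_derivative_iff_has_vector_derivative)
  from prim_on_mult[OF prim_on_linear[OF this bounded_linear_minus[OF bounded_linear_ident]] N]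
  have P: "prim_on (\<lambda>t. - exp (- C * t) * N t) (\<lambda>t. - (- C * exp (- C * t)) * N t + - exp (- C * t) * n t) 0 b" .
  have "- exp (- C * 0) * N 0 \<le> - exp (- C * t) * N t"
  proof (rule prim_on_mono[OF P _ t])
    fix u assume "0 \<le> u" "u \<le> t"
    then have "exp (- C * u) * n u \<le> exp (- C * u) * (C * N u)"
      using le[of u] t by (intro mult_left_mono) auto
    then show "0 \<le> - (- C * exp (- C * u)) * N u + - exp (- C * u) * n u"
      by (simp add: algebra_simps)
  qed auto
  then show ?thesis using N0 by (simp add: mult_le_0_iff)
qed

text \<open>Shared by the unperturbed process (constant rates) and, for each \<open>l\<close>, the
  perturbed one, where the bound grows by the factor \<open>exp (\<bar>l\<bar> * C)\<close>.\<close>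

locale bounded_transition =
  fixes R :: "real \<Rightarrow> 'a::finite \<Rightarrow> 'a \<Rightarrow> real" and p :: "real \<Rightarrow> real \<Rightarrow> 'a \<Rightarrow> 'a \<Rightarrow> real" and K :: real
  assumes transition: "transition_function R p"
    and rate_bound: "\<And>s x y. 0 \<le> s \<Longrightarrow> \<bar>R s x y\<bar> \<le> K"
begin

lemmas p_nonneg = transition_nonneg[OF transition]
  and p_sum = transition_sum[OF transition]
  and p_chapman_kolmogorov = chapman_kolmogorov[OF transition]
  and p_forward = kolmogorov_forward[OF transition]

lemma p_le_1: "0 \<le> s \<Longrightarrow> s \<le> t \<Longrightarrow> p s t x y \<le> 1"
  using member_le_sum[of y UNIV "p s t x"] p_sum[of s t x] p_nonneg[of s t x] by auto

text \<open>The initial condition is hidden in the integrated forward equation: over the degenerate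
  interval \<open>{s..s}\<close> the integral is 0.\<close>

lemma p_refl:
  assumes s: "0 \<le> s"
  shows "p s s x y = of_bool (x = y)"
  using has_integral_unique[OF p_forward[OF s order_refl, unfolded atLeastAtMost_singleton]
      has_integral_refl(2), of x y] by simp

lemma prim_on_transition:
  "prim_on (\<lambda>t. p 0 t x y)
     (\<lambda>t. (\<Sum>z\<in>UNIV. p 0 t x z * R t z y) - p 0 t x y * (\<Sum>z\<in>UNIV. R t y z)) 0 b"
proof (rule prim_onI)
  show "bounded ((\<lambda>t. (\<Sum>z\<in>UNIV. p 0 t x z * R t z y) - p 0 t x y * (\<Sum>z\<in>UNIV. R t y z)) ` {0..b})"
    unfolding bounded_iff
  proof (rule exI[of _ "(\<Sum>z\<in>(UNIV::'a set). 1 * K) + 1 * (\<Sum>z\<in>(UNIV::'a set). K)"], clarify)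
    fix t :: real assume "t \<in> {0..b}"
    then have t: "0 \<le> t" by auto
    have 1: "\<bar>\<Sum>z\<in>UNIV. p 0 t x z * R t z y\<bar> \<le> (\<Sum>z\<in>(UNIV::'a set). 1 * K)"
      by (rule order_trans[OF sum_abs], rule sum_mono, unfold abs_mult, rule mult_mono)
        (use p_nonneg[of 0 t] p_le_1[of 0 t] rate_bound[of t] t in auto)
    have "\<bar>p 0 t x y\<bar> * \<bar>\<Sum>z\<in>UNIV. R t y z\<bar> \<le> 1 * (\<Sum>z\<in>(UNIV::'a set). K)"
      by (rule mult_mono)
        (use p_nonneg[of 0 t x y] p_le_1[of 0 t x y] rate_bound[of t] t in
          \<open>auto simp del: sum_constant intro!: order_trans[OF sum_abs] sum_mono\<close>)
    then have 2: "\<bar>p 0 t x y * (\<Sum>z\<in>UNIV. R t y z)\<bar> \<le> 1 * (\<Sum>z\<in>(UNIV::'a set). K)"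
      by (simp add: abs_mult)
    show "norm ((\<Sum>z\<in>UNIV. p 0 t x z * R t z y) - p 0 t x y * (\<Sum>z\<in>UNIV. R t y z)) \<le>
       (\<Sum>z\<in>(UNIV::'a set). 1 * K) + 1 * (\<Sum>z\<in>(UNIV::'a set). K)"
      unfolding real_norm_def by (rule order_trans[OF abs_triangle_ineq4 add_mono[OF 1 2]])
  qed
  fix t :: real assume "0 \<le> t" "t \<le> b"
  then show "((\<lambda>t. (\<Sum>z\<in>UNIV. p 0 t x z * R t z y) - p 0 t x y * (\<Sum>z\<in>UNIV. R t y z))
      has_integral p 0 t x y - p 0 0 x y) {0..t}"
    using p_forward[of 0 t x y] p_refl[of 0 x y] by simp
qed

text \<open>Dynkin's formula for a time-dependent test function and initial weights
  \<open>m\<close>: the product rule, with the forward derivative of the marginal turned into a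
  generator on \<open>h\<close> by duality. The series representation, the balance over a period and
  the Duhamel bound are three choices of \<open>h\<close>.\<close>

lemma prim_on_dynkin:
  fixes h h' :: "real \<Rightarrow> 'a \<Rightarrow> complex" and m :: "'a \<Rightarrow> real"
  assumes h: "\<And>y. prim_on (\<lambda>t. h t y) (\<lambda>t. h' t y) 0 b"
  defines "\<mu> \<equiv> \<lambda>t y. \<Sum>x\<in>UNIV. m x * p 0 t x y"
  shows "prim_on (\<lambda>t. \<Sum>y\<in>UNIV. of_real (\<mu> t y) * h t y)
    (\<lambda>t. \<Sum>y\<in>UNIV. of_real (\<mu> t y) * (generator (R t) (h t) y + h' t y)) 0 b"
proof -
  let ?\<mu>' = "\<lambda>t y. (\<Sum>z\<in>UNIV. \<mu> t z * R t z y) - \<mu> t y * (\<Sum>z\<in>UNIV. R t y z)"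
  have \<mu>'_eq: "(\<Sum>x\<in>UNIV. m x * ((\<Sum>z\<in>UNIV. p 0 t x z * R t z y) - p 0 t x y * (\<Sum>z\<in>UNIV. R t y z))) = ?\<mu>' t y" for t y
  proof -
    have "(\<Sum>z\<in>UNIV. \<mu> t z * R t z y) = (\<Sum>x\<in>UNIV. m x * (\<Sum>z\<in>UNIV. p 0 t x z * R t z y))"
      unfolding \<mu>_def sum_distrib_left sum_distrib_right
      by (subst sum.swap) (simp add: mult.assoc)
    moreover have "\<mu> t y * (\<Sum>z\<in>UNIV. R t y z) = (\<Sum>x\<in>UNIV. m x * (p 0 t x y * (\<Sum>z\<in>UNIV. R t y z)))"
      unfolding \<mu>_def by (simp add: sum_distrib_right mult.assoc)
    ultimately show ?thesis by (simp add: right_diff_distrib sum_subtractf)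
  qed
  have "prim_on (\<lambda>t. \<mu> t y) (\<lambda>t. ?\<mu>' t y) 0 b" for y
    unfolding \<mu>'_eq[symmetric] unfolding \<mu>_def
    by (intro prim_on_sum prim_on_linear[OF prim_on_transition bounded_linear_mult_right]) auto
  from prim_on_linear[OF this bounded_linear_of_real[where 'a=complex]]
  have "prim_on (\<lambda>t. complex_of_real (\<mu> t y)) (\<lambda>t. of_real (?\<mu>' t y)) 0 b" for y .
  then have "prim_on (\<lambda>t. \<Sum>y\<in>UNIV. of_real (\<mu> t y) * h t y)
      (\<lambda>t. \<Sum>y\<in>UNIV. of_real (?\<mu>' t y) * h t y + of_real (\<mu> t y) * h' t y) 0 b"
    by (intro prim_on_sum prim_on_mult h) auto
  also have "(\<lambda>t. \<Sum>y\<in>UNIV. of_real (?\<mu>' t y) * h t y + of_real (\<mu> t y) * h' t y) =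
      (\<lambda>t. \<Sum>y\<in>UNIV. of_real (\<mu> t y) * (generator (R t) (h t) y + h' t y))"
    unfolding sum.distrib forward_backward_duality distrib_left ..
  finally show ?thesis .
qed

text \<open>The difference of two solutions satisfies a linear equation with zero initial value. Its
  squared Euclidean norm is estimated, since squares, unlike absolute values, are covered by the
  product rule; then Gronwall applies.\<close>

lemma transition_unique:
  assumes q: "transition_function R q" and t: "0 \<le> t"
  shows "q 0 t x y = p 0 t x y"
proof -
  interpret q: bounded_transition R q K by standard (fact q, fact rate_bound)
  define E where "E u y = q 0 u x y - p 0 u x y" for u y
  define E' where "E' u y = (\<Sum>z\<in>UNIV. E u z * R u z y) - E u y * (\<Sum>z\<in>UNIV. R u y z)" for u y
  have E: "prim_on (\<lambda>u. E u y) (\<lambda>u. E' u y) 0 t" for y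
  proof -
    have "prim_on (\<lambda>u. q 0 u x y + - p 0 u x y)
       (\<lambda>u. (\<Sum>z\<in>UNIV. q 0 u x z * R u z y) - q 0 u x y * (\<Sum>z\<in>UNIV. R u y z) +
          - ((\<Sum>z\<in>UNIV. p 0 u x z * R u z y) - p 0 u x y * (\<Sum>z\<in>UNIV. R u y z))) 0 t"
      by (intro prim_on_add q.prim_on_transition
          prim_on_linear[OF prim_on_transition bounded_linear_minus[OF bounded_linear_ident]])
    then show ?thesis
      by (simp add: E_def E'_def left_diff_distrib sum_subtractf algebra_simps)
  qed
  let ?S = "\<lambda>u. \<Sum>y\<in>UNIV. E u y * E u y" and ?n = "real (card (UNIV::'a set))"
  have "prim_on ?S (\<lambda>u. \<Sum>y\<in>UNIV. E' u y * E u y + E u y * E' u y) 0 t"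
    by (intro prim_on_sum prim_on_mult E) auto
  then have "?S t \<le> 0"
  proof (rule prim_on_gronwall)
    fix u assume u: "0 \<le> u" "u \<le> t"
    have K: "0 \<le> K" using rate_bound[OF u(1)] by (meson abs_ge_zero order_trans)
    define A where "A = (\<Sum>y\<in>UNIV. \<bar>E u y\<bar>)"
    \<comment> \<open>Cauchy-Schwarz returns the mixed term to \<open>?S u\<close>, so that the
      estimate closes with the Gronwall constant \<open>4 * ?n * K\<close>.\<close>
    have A2: "A * A \<le> ?n * ?S u"
      using sum_squared_le_sum_of_squares[of "\<lambda>y. \<bar>E u y\<bar>" UNIV]
      by (simp add: A_def power2_eq_square mult.commute)
    have bd: "\<bar>E' u y\<bar> \<le> K * A + ?n * K * \<bar>E u y\<bar>" for y
    proof -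
      have "\<bar>\<Sum>z\<in>UNIV. E u z * R u z y\<bar> \<le> (\<Sum>z\<in>UNIV. \<bar>E u z\<bar> * K)"
        by (rule order_trans[OF sum_abs], rule sum_mono, unfold abs_mult, rule mult_mono)
          (use rate_bound[OF u(1)] in auto)
      then have 1: "\<bar>\<Sum>z\<in>UNIV. E u z * R u z y\<bar> \<le> K * A"
        by (simp add: A_def sum_distrib_left mult.commute)
      have "\<bar>\<Sum>z\<in>UNIV. R u y z\<bar> \<le> (\<Sum>z\<in>(UNIV::'a set). K)"
        by (rule order_trans[OF sum_abs], rule sum_mono, rule rate_bound[OF u(1)])
      then have "\<bar>E u y * (\<Sum>z\<in>UNIV. R u y z)\<bar> \<le> \<bar>E u y\<bar> * (?n * K)"
        unfolding abs_mult by (intro mult_left_mono) auto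
      with 1 show ?thesis unfolding E'_def by (auto simp: mult_ac)
    qed
    have "(\<Sum>y\<in>UNIV. E' u y * E u y + E u y * E' u y) \<le> (\<Sum>y\<in>UNIV. 2 * ((K * A + ?n * K * \<bar>E u y\<bar>) * \<bar>E u y\<bar>))"
    proof (rule sum_mono)
      fix y
      have "E' u y * E u y \<le> \<bar>E' u y\<bar> * \<bar>E u y\<bar>" by (metis abs_ge_self abs_mult)
      also have "\<dots> \<le> (K * A + ?n * K * \<bar>E u y\<bar>) * \<bar>E u y\<bar>" by (intro mult_right_mono bd) auto
      finally show "E' u y * E u y + E u y * E' u y \<le> 2 * ((K * A + ?n * K * \<bar>E u y\<bar>) * \<bar>E u y\<bar>)"
        by (simp add: mult.commute)
    qed
    also have "\<dots> = (\<Sum>y\<in>UNIV. 2 * K * A * \<bar>E u y\<bar> + 2 * ?n * K * (E u y * E u y))"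
      by (rule sum.cong) (simp_all add: algebra_simps flip: abs_mult)
    also have "\<dots> = 2 * (K * (A * A) + ?n * K * ?S u)"
      unfolding sum.distrib sum_distrib_left[symmetric] A_def[symmetric] by (simp add: algebra_simps)
    also have "\<dots> \<le> 2 * (K * (?n * ?S u) + ?n * K * ?S u)"
      using A2 K by (intro mult_left_mono add_right_mono) auto
    also have "\<dots> = (4 * ?n * K) * ?S u" by simp
    finally show "(\<Sum>y\<in>UNIV. E' u y * E u y + E u y * E' u y) \<le> (4 * ?n * K) * ?S u" .
  next
    show "?S 0 = 0" by (simp add: E_def p_refl q.p_refl)
  qed (use t in auto)
  then have "?S t = 0" by (simp add: order_antisym sum_nonneg)
  then have "E t y * E t y = 0" by (subst (asm) sum_nonneg_eq_0_iff) auto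
  then show ?thesis by (simp add: E_def)
qed

text \<open>The kernel shifted by a period solves the same equation, so uniqueness identifies the
  two. For constant rates every \<open>a\<close> is a period, which gives time homogeneity.\<close>

lemma transition_periodic:
  assumes "0 \<le> a" "\<And>s. R (a + s) = R s" "0 \<le> t"
  shows "p a (a + t) x y = p 0 t x y"
proof -
  have "transition_function R (\<lambda>s t. p (a + s) (a + t))"
    using transition_function_shift[OF transition assms(1)] assms(2) by simp
  from transition_unique[OF this assms(3)] show ?thesis by simp
qed

end

section \<open>The operator exponential of the generator\<close>

definition semigroup_gen :: "('a::finite \<Rightarrow> 'a \<Rightarrow> real) \<Rightarrow> complex \<Rightarrow> ('a \<Rightarrow> complex) \<Rightarrow> 'a \<Rightarrow> complex" where
  "semigroup_gen r c h x = generator r h x + c * h x"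

text \<open>The factor \<open>s\<close> stays inside the operator so that the expression in the
  theorem is literally an instance; \<open>gen_exp_series\<close> extracts it as a power-series
  variable.\<close>

definition gen_exp :: "('a::finite \<Rightarrow> 'a \<Rightarrow> real) \<Rightarrow> complex \<Rightarrow> real \<Rightarrow> ('a \<Rightarrow> complex) \<Rightarrow> 'a \<Rightarrow> complex" where
  "gen_exp r c s = op_exp (\<lambda>h x. of_real s * (generator r h x + c * h x))"

lemma semigroup_gen_cmult: "semigroup_gen r c (\<lambda>y. a * f y) x = a * semigroup_gen r c f x"
  by (simp add: semigroup_gen_def generator_cmult algebra_simps)

text \<open>Summing over all rows makes the constant independent of \<open>x\<close>, so the bound
  can be iterated along powers of the operator.\<close>

lemma semigroup_gen_bound:
  assumes "\<And>x. norm (f x) \<le> B"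
  shows "norm (semigroup_gen r c f x) \<le> ((\<Sum>x\<in>UNIV. \<Sum>y\<in>UNIV. 2 * \<bar>r x y\<bar>) + norm c) * B"
proof -
  have B: "0 \<le> B" using assms by (meson norm_ge_zero order_trans)
  have "norm (generator r f x) \<le> (\<Sum>y\<in>UNIV. 2 * \<bar>r x y\<bar> * B)"
    unfolding generator_def
  proof (rule sum_norm_le)
    fix y
    have "norm (f y - f x) \<le> 2 * B"
      using norm_triangle_ineq4[of "f y" "f x"] assms[of x] assms[of y] by linarith
    then have "\<bar>r x y\<bar> * norm (f y - f x) \<le> \<bar>r x y\<bar> * (2 * B)" by (rule mult_left_mono) simp
    then show "norm (of_real (r x y) * (f y - f x)) \<le> 2 * \<bar>r x y\<bar> * B" by (simp add: norm_mult mult_ac)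
  qed
  also have "\<dots> = (\<Sum>y\<in>UNIV. 2 * \<bar>r x y\<bar>) * B" by (simp add: sum_distrib_right)
  also have "\<dots> \<le> (\<Sum>x\<in>UNIV. \<Sum>y\<in>UNIV. 2 * \<bar>r x y\<bar>) * B"
    by (rule mult_right_mono[OF _ B], rule member_le_sum[where f = "\<lambda>x. \<Sum>y\<in>UNIV. 2 * \<bar>r x y\<bar>"])
      (auto intro: sum_nonneg)
  finally have 1: "norm (generator r f x) \<le> (\<Sum>x\<in>UNIV. \<Sum>y\<in>UNIV. 2 * \<bar>r x y\<bar>) * B" .
  have 2: "norm (c * f x) \<le> norm c * B" unfolding norm_mult by (intro mult_left_mono assms) auto
  show ?thesis
    unfolding semigroup_gen_def distrib_right
    by (rule order_trans[OF norm_triangle_ineq add_mono[OF 1 2]])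
qed

lemma semigroup_gen_funpow_bound:
  assumes f: "\<And>x. norm (f x) \<le> B"
  shows "norm ((semigroup_gen r c ^^ n) f x) \<le> ((\<Sum>x\<in>UNIV. \<Sum>y\<in>UNIV. 2 * \<bar>r x y\<bar>) + norm c) ^ n * B"
proof (induction n arbitrary: x)
  case (Suc n)
  from semigroup_gen_bound[OF Suc.IH] show ?case by (simp add: mult.assoc)
qed (use f in simp)

lemma semigroup_gen_series_summable:
  "summable (\<lambda>n. ((semigroup_gen r c ^^ n) f x / fact n) * z ^ n)"
proof -
  define A where "A = (\<Sum>x\<in>UNIV. \<Sum>y\<in>UNIV. 2 * \<bar>r x y\<bar>) + norm c"
  define B where "B = (\<Sum>x\<in>UNIV. norm (f x))"
  have B: "norm (f x) \<le> B" for x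
    unfolding B_def by (rule member_le_sum[where f = "\<lambda>x. norm (f x)"]) auto
  have "summable (\<lambda>n. B * (inverse (fact n) * (A * norm z) ^ n))"
    by (intro summable_mult summable_exp)
  then show ?thesis
  proof (rule summable_comparison_test'[where N = 0])
    fix n
    have "norm ((semigroup_gen r c ^^ n) f x) * (norm z ^ n / fact n) \<le> (A ^ n * B) * (norm z ^ n / fact n)"
      unfolding A_def by (intro mult_right_mono semigroup_gen_funpow_bound B) auto
    then show "norm ((semigroup_gen r c ^^ n) f x / fact n * z ^ n) \<le> B * (inverse (fact n) * (A * norm z) ^ n)"
      by (simp add: norm_mult norm_divide norm_power power_mult_distrib field_simps)
  qed
qed

lemma gen_exp_series:
  "gen_exp r c s f x = (\<Sum>n. ((semigroup_gen r c ^^ n) f x / fact n) * of_real s ^ n)"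
proof -
  have "((\<lambda>h x. of_real s * semigroup_gen r c h x) ^^ n) f = (\<lambda>x. of_real s ^ n * (semigroup_gen r c ^^ n) f x)" for n
    by (induction n) (simp_all add: semigroup_gen_cmult mult_ac)
  then show ?thesis
    unfolding gen_exp_def op_exp_def semigroup_gen_def[symmetric] by (simp add: mult_ac)
qed

lemma gen_exp_0: "gen_exp r c 0 f x = f x"
proof -
  have "(\<lambda>n. ((semigroup_gen r c ^^ n) f x / fact n) * (0::complex) ^ n) sums ((semigroup_gen r c ^^ 0) f x / fact 0)"
    by (rule powser_sums_zero)
  then show ?thesis unfolding gen_exp_series by (simp add: sums_iff)
qed

lemma gen_exp_has_vector_derivative:
  "((\<lambda>s. gen_exp r c s f x) has_vector_derivative
     (generator r (gen_exp r c s f) x + c * gen_exp r c s f x)) (at s within S)"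
proof -
  define a where "a x n = (semigroup_gen r c ^^ n) f x / fact n" for x n
  define z where "z = complex_of_real s"
  have sm: "summable (\<lambda>n. a x n * w ^ n)" for x w
    unfolding a_def by (rule semigroup_gen_series_summable)
  have sums: "(\<lambda>n. a x n * z ^ n) sums gen_exp r c s f x" for x
    using sm[of x z] unfolding gen_exp_series a_def z_def by (rule summable_sums)
  have "(\<lambda>n. semigroup_gen r c (\<lambda>x. a x n * z ^ n) x) sums (semigroup_gen r c (gen_exp r c s f) x)"
    unfolding semigroup_gen_def generator_def
    by (intro sums_add sums_sum sums_mult sums_diff sums)
  \<comment> \<open>One more application of the operator produces the next coefficient times
    \<open>n + 1\<close>, which is the coefficient of the termwise derivative.\<close>
  moreover have "semigroup_gen r c (\<lambda>x. a x n * z ^ n) x = diffs (a x) n * z ^ n" for n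
  proof -
    have "semigroup_gen r c (\<lambda>x. a x n * z ^ n) x =
        semigroup_gen r c (\<lambda>x. (z ^ n / fact n) * (semigroup_gen r c ^^ n) f x) x"
      by (simp add: a_def mult.commute)
    also have "\<dots> = (z ^ n / fact n) * semigroup_gen r c ((semigroup_gen r c ^^ n) f) x"
      by (rule semigroup_gen_cmult)
    also have "\<dots> = diffs (a x) n * z ^ n"
      by (simp add: diffs_def a_def field_simps del: of_nat_Suc)
    finally show ?thesis .
  qed
  ultimately have "(\<Sum>n. diffs (a x) n * z ^ n) = semigroup_gen r c (gen_exp r c s f) x"
    by (simp add: sums_iff)
  with termdiffs_strong_converges_everywhere[OF sm, of x z]
  have "((\<lambda>w. \<Sum>n. a x n * w ^ n) has_field_derivative semigroup_gen r c (gen_exp r c s f) x) (at (of_real s))"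
    by (simp add: z_def)
  from has_vector_derivative_real_field[OF this, of S] show ?thesis
    by (simp add: gen_exp_series a_def semigroup_gen_def)
qed

lemma gen_exp_continuous: "continuous_on S (\<lambda>s. gen_exp r c s f x)"
  by (rule continuous_on_vector_derivative[OF gen_exp_has_vector_derivative])

locale homogeneous_transition = bounded_transition "\<lambda>s. r" p K
  for r :: "'a::finite \<Rightarrow> 'a \<Rightarrow> real" and p K
begin

text \<open>For a path started at \<open>x\<close>, the mean of \<open>exp (t c)\<close> times the
  exponential at time \<open>s - t\<close>, evaluated at the position at time \<open>t\<close>, does
  not depend on \<open>t\<close>. Its values at \<open>t = 0\<close> and \<open>t = s\<close> are
  the two sides.\<close>

lemma gen_exp_eq_transition:
  assumes s: "0 \<le> s"
  shows "gen_exp r c s f x = exp (of_real s * c) * (\<Sum>y\<in>UNIV. of_real (p 0 s x y) * f y)"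
proof -
  let ?h = "\<lambda>t y. exp (of_real t * c) * gen_exp r c (s - t) f y"
  \<comment> \<open>The derivative of \<open>exp (t c)\<close> contributes \<open>+ c\<close> and
    that of the exponential at \<open>s - t\<close> contributes \<open>- (L + c)\<close>. What
    remains is \<open>- L\<close>, which cancels the generator term in Dynkin's formula.\<close>
  let ?h' = "\<lambda>t y. - (exp (of_real t * c) * generator r (gen_exp r c (s - t) f) y)"
  have h: "prim_on (\<lambda>t. ?h t y) (\<lambda>t. ?h' t y) 0 s" for y
  proof (rule prim_on_vector_derivative)
    fix t :: real
    have 1: "((\<lambda>t. exp (of_real t * c)) has_vector_derivative (c * exp (of_real t * c))) (at t within {0..s})"
      by (rule has_vector_derivative_real_field) (auto intro!: derivative_eq_intros)
    have "((\<lambda>t. s - t) has_vector_derivative (- 1)) (at t within {0..s})"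
      by (auto intro!: derivative_eq_intros)
    from vector_diff_chain_within[OF this gen_exp_has_vector_derivative, of r c f y]
    have 2: "((\<lambda>t. gen_exp r c (s - t) f y) has_vector_derivative
       - (generator r (gen_exp r c (s - t) f) y + c * gen_exp r c (s - t) f y)) (at t within {0..s})"
      by (simp add: o_def)
    show "((\<lambda>t. ?h t y) has_vector_derivative ?h' t y) (at t within {0..s})"
      using has_vector_derivative_mult[OF 1 2] by (simp add: algebra_simps)
  next
    have "continuous_on {0..s} (\<lambda>t. gen_exp r c (s - t) f y)" for y
      by (rule continuous_on_compose2[OF gen_exp_continuous[of UNIV]]) (auto intro!: continuous_intros)
    then show "continuous_on {0..s} (\<lambda>t. ?h' t y)"
      unfolding generator_def by (intro continuous_intros)
  qed
  \<comment> \<open>The initial weights are the point mass at \<open>x\<close>.\<close>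
  have "prim_on (\<lambda>t. \<Sum>y\<in>UNIV. of_real (\<Sum>z\<in>UNIV. of_bool (z = x) * p 0 t z y) * ?h t y)
      (\<lambda>t. \<Sum>y\<in>UNIV. of_real (\<Sum>z\<in>UNIV. of_bool (z = x) * p 0 t z y) * (generator r (?h t) y + ?h' t y)) 0 s"
    by (rule prim_on_dynkin[OF h])
  then have "prim_on (\<lambda>t. \<Sum>y\<in>UNIV. of_real (p 0 t x y) * ?h t y) (\<lambda>t. 0) 0 s"
    by (simp add: generator_cmult of_bool_def if_distrib[of "\<lambda>x. x * _"] cong: if_cong)
  from prim_onD[OF this, of 0 s] s
  have "(\<Sum>y\<in>UNIV. of_real (p 0 s x y) * ?h s y) - (\<Sum>y\<in>UNIV. of_real (p 0 0 x y) * ?h 0 y) = 0"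
    by (auto dest: has_integral_unique[OF has_integral_0])
  moreover have "(\<Sum>y\<in>UNIV. of_real (p 0 0 x y) * ?h 0 y) = gen_exp r c s f x"
    by (simp add: p_refl of_bool_def if_distrib[of "\<lambda>x. x * _"] if_distrib[of of_real] cong: if_cong)
  ultimately show ?thesis by (simp add: gen_exp_0 sum_distrib_left mult_ac)
qed

lemma transition_homogeneous:
  assumes "0 \<le> s" "0 \<le> t"
  shows "p s (s + t) x y = p 0 t x y"
  by (rule transition_periodic) (use assms in auto)

end

section \<open>Exponential ergodicity\<close>

locale irreducible_transition = homogeneous_transition +
  assumes r_nonneg: "0 \<le> r x y" and irred: "irreducible_rates r"
begin

text \<open>The integrating factor turns the loss term of the forward equation into monotonicity.\<close>

definition weighted :: "'a \<Rightarrow> 'a \<Rightarrow> real \<Rightarrow> real" where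
  "weighted x y t = exp ((\<Sum>z\<in>UNIV. r y z) * t) * p 0 t x y"

lemma prim_on_weighted:
  "prim_on (weighted x y) (\<lambda>t. exp ((\<Sum>z\<in>UNIV. r y z) * t) * (\<Sum>z\<in>UNIV. p 0 t x z * r z y)) 0 b"
proof -
  let ?q = "\<Sum>z\<in>UNIV. r y z"
  have "prim_on (\<lambda>t. exp (?q * t)) (\<lambda>t. ?q * exp (?q * t)) 0 b"
    by (rule prim_on_vector_derivative)
      (auto intro!: derivative_eq_intros continuous_intros simp flip: has_real_derivative_iff_has_vector_derivative)
  from prim_on_mult[OF this prim_on_transition[of x y b]] show ?thesis
    unfolding weighted_def[abs_def] by (simp add: algebra_simps)
qed

lemma weighted_mono:
  assumes "0 \<le> s" "s \<le> t"
  shows "weighted x y s \<le> weighted x y t"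
  by (rule prim_on_mono[OF prim_on_weighted assms order_refl])
    (use assms in \<open>auto intro!: mult_nonneg_nonneg sum_nonneg p_nonneg r_nonneg\<close>)

lemma weighted_pos_iff: "0 < weighted x y t \<longleftrightarrow> 0 < p 0 t x y"
  by (simp add: weighted_def zero_less_mult_iff)

text \<open>On \<open>{t/2..t}\<close> the probability of being at \<open>z\<close> is bounded
  below, since its weighted version is monotone. The inflow from \<open>z\<close> to
  \<open>y\<close> over this interval is then strictly positive.\<close>

lemma transition_pos_step:
  assumes z: "\<And>t. 0 < t \<Longrightarrow> 0 < p 0 t x z" and r: "0 < r z y" and t: "0 < t"
  shows "0 < p 0 t x y"
proof -
  let ?f = "\<lambda>t. exp ((\<Sum>z\<in>UNIV. r y z) * t) * (\<Sum>z\<in>UNIV. p 0 t x z * r z y)"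
  \<comment> \<open>A lower bound on the inflow: the weighted function is smallest at the left end
    \<open>t/2\<close>, the factor undoing its weight is smallest at the right end \<open>t\<close>,
    and the weight of \<open>y\<close> is at least 1.\<close>
  let ?c = "exp (- (\<Sum>w\<in>UNIV. r z w) * t) * weighted x z (t/2) * r z y"
  have int: "(?f has_integral (weighted x y t - weighted x y (t/2))) {t/2..t}"
    by (rule prim_onD[OF prim_on_weighted]) (use t in auto)
  have ge: "?c \<le> ?f u" if u: "u \<in> {t/2..t}" for u
  proof -
    have u0: "0 \<le> u" using u t by auto
    have "?c \<le> exp (- (\<Sum>w\<in>UNIV. r z w) * u) * weighted x z u * r z y"
      using u t r u0 p_nonneg[of 0 "t/2" x z] p_nonneg[of 0 u x z]
      by (intro mult_mono weighted_mono) (auto simp: weighted_def intro!: mult_left_mono sum_nonneg r_nonneg)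
    also have "\<dots> = p 0 u x z * r z y"
      by (simp add: weighted_def flip: exp_add)
    also have "\<dots> \<le> (\<Sum>z\<in>UNIV. p 0 u x z * r z y)"
      by (rule member_le_sum) (use u0 in \<open>auto intro!: mult_nonneg_nonneg p_nonneg r_nonneg\<close>)
    also have "\<dots> \<le> ?f u"
    proof -
      have "1 * (\<Sum>z\<in>UNIV. p 0 u x z * r z y) \<le> ?f u"
        by (rule mult_right_mono)
          (use u0 in \<open>auto intro!: mult_nonneg_nonneg sum_nonneg p_nonneg r_nonneg\<close>)
      then show ?thesis by simp
    qed
    finally show ?thesis .
  qed
  have "(t/2) * ?c \<le> weighted x y t - weighted x y (t/2)"
    using has_integral_le[OF has_integral_const_real[of ?c "t/2" t] int ge] t by simp
  moreover have "0 < (t/2) * ?c"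
    using t r z[of "t/2"] by (auto simp: weighted_pos_iff intro!: mult_pos_pos)
  moreover have "0 \<le> weighted x y (t/2)" using p_nonneg[of 0 "t/2" x y] t by (simp add: weighted_def)
  ultimately show ?thesis using weighted_pos_iff[of x y t] by linarith
qed

lemma transition_pos:
  assumes "0 < t"
  shows "0 < p 0 t x y"
proof -
  have "(x, y) \<in> {(u, w). r u w > 0}\<^sup>*" using irred by (simp add: irreducible_rates_def)
  \<comment> \<open>All positive times are carried through the induction along a path of positive
    rates, because one more jump uses positivity at an earlier time.\<close>
  then have "\<forall>t>0. 0 < p 0 t x y"
  proof (induction rule: rtrancl_induct)
    case base
    have "0 < weighted x x t" if "0 < t" for t
      using weighted_mono[of 0 t x x] that by (simp add: weighted_def p_refl)
    then show ?case by (simp add: weighted_pos_iff)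
  next
    case (step y z)
    then show ?case by (auto intro: transition_pos_step)
  qed
  with assms show ?thesis by simp
qed

end

locale stationary_transition = irreducible_transition +
  fixes \<pi> :: "'a \<Rightarrow> real"
  assumes invariant: "0 \<le> t \<Longrightarrow> invariant_distribution (p 0 t) \<pi>"
begin

lemma \<pi>_nonneg: "0 \<le> \<pi> x" and \<pi>_sum: "(\<Sum>x\<in>UNIV. \<pi> x) = 1"
  using invariant[of 0] by (auto simp: invariant_distribution_def)

lemma \<pi>_invariant: "0 \<le> t \<Longrightarrow> (\<Sum>x\<in>UNIV. \<pi> x * p 0 t x y) = \<pi> y"
  using invariant[of t] by (auto simp: invariant_distribution_def)

text \<open>Full support is what lets the division by \<open>\<pi> x\<close> in
  \<open>reversed_rate\<close> be cancelled later.\<close>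

lemma \<pi>_pos: "0 < \<pi> y"
proof -
  obtain x where "\<pi> x \<noteq> 0" using \<pi>_sum by (metis sum.neutral zero_neq_one)
  then have "0 < \<pi> x" using \<pi>_nonneg[of x] by auto
  then have "0 < \<pi> x * p 0 1 x y" using transition_pos[of 1 x y] by simp
  also have "\<dots> \<le> (\<Sum>x\<in>UNIV. \<pi> x * p 0 1 x y)"
    by (rule member_le_sum) (auto intro!: mult_nonneg_nonneg \<pi>_nonneg p_nonneg)
  finally show ?thesis using \<pi>_invariant[of 1 y] by simp
qed

text \<open>The Markov semigroup in kernel form. Positivity and unit mass are visible here, whereas
  differentiability in time is visible in \<open>gen_exp\<close>; the two are linked by
  \<open>gen_exp_eq_P\<close>.\<close>

definition P :: "real \<Rightarrow> ('a \<Rightarrow> complex) \<Rightarrow> 'a \<Rightarrow> complex" where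
  "P t f x = (\<Sum>y\<in>UNIV. of_real (p 0 t x y) * f y)"

lemma P_mean:
  assumes "0 \<le> t"
  shows "(\<Sum>x\<in>UNIV. of_real (\<pi> x) * P t f x) = (\<Sum>x\<in>UNIV. of_real (\<pi> x) * f x)"
proof -
  have "(\<Sum>x\<in>UNIV. of_real (\<pi> x) * P t f x) = (\<Sum>y\<in>UNIV. \<Sum>x\<in>UNIV. of_real (\<pi> x * p 0 t x y) * f y)"
    unfolding P_def sum_distrib_left by (subst sum.swap) (simp add: mult.assoc)
  also have "\<dots> = (\<Sum>y\<in>UNIV. of_real (\<Sum>x\<in>UNIV. \<pi> x * p 0 t x y) * f y)"
    by (simp add: sum_distrib_right)
  finally show ?thesis by (simp add: \<pi>_invariant[OF assms])
qed

lemma P_add: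
  assumes "0 \<le> s" "0 \<le> t"
  shows "P (s + t) f x = P s (P t f) x"
proof -
  have "P (s + t) f x = (\<Sum>y\<in>UNIV. \<Sum>z\<in>UNIV. of_real (p 0 s x z) * (of_real (p 0 t z y) * f y))"
    using p_chapman_kolmogorov[of 0 s "s + t" x] assms
    by (simp add: P_def transition_homogeneous sum_distrib_right mult.assoc)
  also have "\<dots> = P s (P t f) x"
    unfolding P_def sum_distrib_left by (rule sum.swap)
  finally show ?thesis .
qed

lemma P_contraction:
  assumes "0 \<le> t" "\<And>x. norm (f x) \<le> B"
  shows "norm (P t f x) \<le> B"
proof -
  have "norm (P t f x) \<le> (\<Sum>y\<in>UNIV. p 0 t x y * B)"
    unfolding P_def
    by (rule sum_norm_le) (use assms p_nonneg[of 0 t x] in \<open>auto simp: norm_mult intro!: mult_left_mono\<close>)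
  also have "\<dots> = B" using p_sum[of 0 t x] assms by (simp flip: sum_distrib_right)
  finally show ?thesis .
qed

text \<open>Finiteness of the state space turns strict positivity at time 1 into a uniform
  minorisation.\<close>

lemma doeblin:
  obtains \<delta> where "0 < \<delta>" "\<delta> \<le> 1" "\<And>x y. \<delta> \<le> p 0 1 x y"
proof -
  let ?A = "range (\<lambda>(x, y). p 0 1 x y)"
  have "Min ?A \<in> ?A" by (rule Min_in) auto
  then have "0 < Min ?A" using transition_pos[of 1] by force
  moreover have "Min ?A \<le> p 0 1 x y" for x y by (rule Min_le) (auto intro: rev_image_eqI[of "(x, y)"])
  moreover from this have "Min ?A \<le> 1" using p_le_1[of 0 1] by (meson order_trans zero_le_one order_refl)
  ultimately show ?thesis using that by blast
qed

text \<open>On mean-zero functions the kernel \<open>p 0 1 x y\<close> may be replaced by \<open>p 0 1 x y - \<delta> * \<pi> y \<ge> 0\<close>, whose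
  total mass is \<open>1 - \<delta>\<close>.\<close>

lemma P_strict_contraction:
  assumes \<delta>: "\<And>x y. \<delta> \<le> p 0 1 x y" "0 \<le> \<delta>"
    and mean: "(\<Sum>x\<in>UNIV. of_real (\<pi> x) * f x) = 0" and B: "\<And>x. norm (f x) \<le> B"
  shows "norm (P 1 f x) \<le> (1 - \<delta>) * B"
proof -
  have "P 1 f x = P 1 f x - of_real \<delta> * (\<Sum>y\<in>UNIV. of_real (\<pi> y) * f y)" using mean by simp
  also have "\<dots> = (\<Sum>y\<in>UNIV. of_real (p 0 1 x y - \<delta> * \<pi> y) * f y)"
    by (simp add: P_def sum_distrib_left left_diff_distrib sum_subtractf mult.assoc)
  also have "norm \<dots> \<le> (\<Sum>y\<in>UNIV. (p 0 1 x y - \<delta> * \<pi> y) * B)"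
  proof (rule sum_norm_le)
    fix y
    have "\<pi> y \<le> 1" using member_le_sum[of y UNIV \<pi>] \<pi>_sum \<pi>_nonneg by auto
    then have "\<delta> * \<pi> y \<le> p 0 1 x y"
      using \<delta>(1)[of x y] \<delta>(2) mult_left_le[of "\<pi> y" \<delta>] by linarith
    then show "norm (of_real (p 0 1 x y - \<delta> * \<pi> y) * f y) \<le> (p 0 1 x y - \<delta> * \<pi> y) * B"
      unfolding norm_mult norm_of_real by (intro mult_mono B) auto
  qed
  also have "\<dots> = (1 - \<delta>) * B"
    using p_sum[of 0 1 x] \<pi>_sum
    by (simp add: sum_subtractf flip: sum_distrib_right sum_distrib_left)
  finally show ?thesis .
qed

lemma P_exponential_decay:
  assumes mean: "(\<Sum>x\<in>UNIV. of_real (\<pi> x) * f x) = 0"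
  shows "\<exists>\<alpha>>0. \<exists>C\<ge>0. \<forall>t\<ge>0. \<forall>x. norm (P t f x) \<le> C * exp (- \<alpha> * t)"
proof -
  obtain \<delta> where \<delta>: "0 < \<delta>" "\<delta> \<le> 1" "\<And>x y. \<delta> \<le> p 0 1 x y" using doeblin by blast
  define B where "B = (\<Sum>x\<in>UNIV. norm (f x))"
  have B: "norm (f x) \<le> B" for x
    unfolding B_def by (rule member_le_sum[where f = "\<lambda>x. norm (f x)"]) auto
  have B0: "0 \<le> B" unfolding B_def by (rule sum_nonneg) auto
  \<comment> \<open>The fractional time \<open>u\<close> only contracts weakly; each full unit of
    time gains a factor \<open>1 - \<delta>\<close>, because invariance of \<open>\<pi>\<close>
    keeps the mean at zero.\<close>
  have step: "norm (P (real n + u) f x) \<le> (1 - \<delta>) ^ n * B" if u: "0 \<le> u" for n u x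
  proof (induction n arbitrary: x)
    case 0
    show ?case using P_contraction[OF u B] by simp
  next
    case (Suc n)
    have "P (real (Suc n) + u) f x = P 1 (P (real n + u) f) x"
      using P_add[of 1 "real n + u" f x] u by (simp add: add_ac)
    also have "norm \<dots> \<le> (1 - \<delta>) * ((1 - \<delta>) ^ n * B)"
      by (rule P_strict_contraction[OF \<delta>(3)])
        (use \<delta> mean P_mean[of "real n + u" f] u Suc.IH in auto)
    finally show ?case by (simp add: mult.assoc)
  qed
  \<comment> \<open>The rate is \<open>\<delta>\<close> by
    \<open>1 - \<delta> \<le> exp (- \<delta>)\<close>, and the factor \<open>exp \<delta>\<close>
    pays for rounding \<open>t\<close> down to an integer.\<close>
  show ?thesis
  proof (rule exI[of _ \<delta>], intro exI[of _ "B * exp \<delta>"] conjI allI impI)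
    fix t :: real and x assume t: "0 \<le> t"
    define n where "n = nat \<lfloor>t\<rfloor>"
    have n: "real n \<le> t" "t < real n + 1" using t by (auto simp: n_def)
    have "norm (P t f x) \<le> (1 - \<delta>) ^ n * B" using step[of "t - real n" n x] n by simp
    also have "\<dots> \<le> exp (- \<delta>) ^ n * B"
      using exp_ge_add_one_self[of "- \<delta>"] \<delta> B0 by (intro mult_right_mono power_mono) auto
    also have "exp (- \<delta>) ^ n = exp (real n * (- \<delta>))" by (rule exp_of_nat_mult[symmetric])
    also have "\<dots> * B \<le> exp (\<delta> - \<delta> * t) * B"
    proof (rule mult_right_mono[OF _ B0])
      have "\<delta> * t \<le> \<delta> * (real n + 1)" using n \<delta> by (intro mult_left_mono) auto
      then show "exp (real n * (- \<delta>)) \<le> exp (\<delta> - \<delta> * t)" by (simp add: algebra_simps)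
    qed
    also have "\<dots> = B * exp \<delta> * exp (- \<delta> * t)" by (simp flip: exp_add)
    finally show "norm (P t f x) \<le> B * exp \<delta> * exp (- \<delta> * t)" .
  qed (use \<delta> B0 in auto)
qed

end

section \<open>Integration auxiliaries, periodic marginals and the balance over one period\<close>

lemma set_integral_sum:
  fixes f :: "'i \<Rightarrow> 'b \<Rightarrow> 'c::{banach, second_countable_topology}"
  assumes "\<And>i. i \<in> I \<Longrightarrow> set_integrable M A (f i)"
  shows "set_integrable M A (\<lambda>x. \<Sum>i\<in>I. f i x)"
    and "(LINT x:A|M. (\<Sum>i\<in>I. f i x)) = (\<Sum>i\<in>I. LINT x:A|M. f i x)"
  using assms unfolding set_integrable_def set_lebesgue_integral_def scaleR_sum_right
  by (auto intro!: Bochner_Integration.integrable_sum Bochner_Integration.integral_sum)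

lemma exp_decay_tendsto_0:
  fixes \<alpha> C :: real
  assumes "0 < \<alpha>"
  shows "((\<lambda>t. C * exp (- \<alpha> * t)) \<longlongrightarrow> 0) at_top"
proof -
  have "((\<lambda>t. C * exp (- \<alpha> * t)) \<longlongrightarrow> C * 0) at_top"
    using assms
    by (intro tendsto_mult_left filterlim_compose[OF exp_at_bot]
        filterlim_tendsto_neg_mult_at_bot[OF tendsto_const _ filterlim_ident]) auto
  then show ?thesis by simp
qed

context bounded_transition
begin

text \<open>The first period is split off by Chapman-Kolmogorov: \<open>m\<close> absorbs
  \<open>p 0 T\<close>, and the remaining kernel is shifted back by periodicity. Besides the
  periodicity claim, this gives access to arbitrarily late times.\<close>

lemma periodic_marginal:
  assumes R: "\<And>s. R (T + s) = R s" and T: "0 \<le> T" and m: "invariant_distribution (p 0 T) m"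
    and t: "0 \<le> t"
  shows "(\<Sum>x\<in>UNIV. m x * p 0 (t + real n * T) x y) = (\<Sum>x\<in>UNIV. m x * p 0 t x y)"
proof (induction n)
  case (Suc n)
  let ?t = "t + real n * T"
  have t': "0 \<le> ?t" using t T by simp
  have "(\<Sum>x\<in>UNIV. m x * p 0 (T + ?t) x y) = (\<Sum>x\<in>UNIV. \<Sum>z\<in>UNIV. m x * p 0 T x z * p 0 ?t z y)"
    using p_chapman_kolmogorov[of 0 T "T + ?t"] transition_periodic[OF T R t'] t' T
    by (simp add: sum_distrib_left mult.assoc)
  also have "\<dots> = (\<Sum>z\<in>UNIV. (\<Sum>x\<in>UNIV. m x * p 0 T x z) * p 0 ?t z y)"
    by (subst sum.swap) (simp add: sum_distrib_right)
  also have "\<dots> = (\<Sum>x\<in>UNIV. m x * p 0 ?t x y)"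
    using m by (simp add: invariant_distribution_def)
  finally show ?case using Suc.IH by (simp add: algebra_simps)
qed simp

lemma marginal_distribution:
  assumes m: "\<And>x. 0 \<le> m x" "(\<Sum>x\<in>UNIV. m x) = 1" and t: "0 \<le> t"
  shows "0 \<le> (\<Sum>x\<in>UNIV. m x * p 0 t x y)" "(\<Sum>y\<in>UNIV. \<Sum>x\<in>UNIV. m x * p 0 t x y) = 1"
proof -
  show "0 \<le> (\<Sum>x\<in>UNIV. m x * p 0 t x y)"
    by (intro sum_nonneg mult_nonneg_nonneg m p_nonneg t order_refl)
  show "(\<Sum>y\<in>UNIV. \<Sum>x\<in>UNIV. m x * p 0 t x y) = 1"
    by (subst sum.swap) (use p_sum[of 0 t] t m in \<open>simp flip: sum_distrib_left\<close>)
qed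

lemma marginal_le_1:
  assumes m: "\<And>x. 0 \<le> m x" "(\<Sum>x\<in>UNIV. m x) = 1" and t: "0 \<le> t"
  shows "(\<Sum>x\<in>UNIV. m x * p 0 t x y) \<le> 1"
  using member_le_sum[of y UNIV "\<lambda>y. \<Sum>x\<in>UNIV. m x * p 0 t x y"] marginal_distribution[OF assms] by auto

text \<open>An exact identity for the given rates, without any smallness. The side with
  \<open>R t\<close> is only measurable in time and is therefore stated with
  \<open>has_integral\<close>; the other side is continuous, and this is recorded because it permits
  passing between gauge and Lebesgue integrals.\<close>

lemma fourier_balance:
  fixes m :: "'a \<Rightarrow> real" and f H :: "'a \<Rightarrow> complex"
  assumes T: "0 \<le> T" and m: "invariant_distribution (p 0 T) m"
    and c: "exp (of_real T * c) = 1"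
    and poisson: "\<And>y. generator r H y + c * H y = - f y"
  defines "\<mu> \<equiv> \<lambda>t y. \<Sum>x\<in>UNIV. m x * p 0 t x y"
  shows "((\<lambda>t. exp (of_real t * c) * (\<Sum>y\<in>UNIV. of_real (\<mu> t y) * (generator (R t) H y - generator r H y)))
    has_integral (integral {0..T} (\<lambda>t. exp (of_real t * c) * (\<Sum>y\<in>UNIV. of_real (\<mu> t y) * f y)))) {0..T}"
    and "continuous_on {0..T} (\<lambda>t. \<Sum>y\<in>UNIV. of_real (\<mu> t y) * f y)"
proof -
  have exp_deriv: "((\<lambda>t. exp (of_real t * c)) has_vector_derivative (c * exp (of_real t * c))) (at t within S)" for t S
    by (rule has_vector_derivative_real_field) (auto intro!: derivative_eq_intros)
  have "prim_on (\<lambda>t. exp (of_real t * c) * H y) (\<lambda>t. c * exp (of_real t * c) * H y) 0 T" for y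
  proof (rule prim_on_vector_derivative)
    show "((\<lambda>t. exp (of_real t * c) * H y) has_vector_derivative c * exp (of_real t * c) * H y) (at t within {0..T})" for t
      using has_vector_derivative_mult[OF exp_deriv has_vector_derivative_const] by simp
  qed (intro continuous_intros)
  from prim_on_dynkin[where h = "\<lambda>t y. exp (of_real t * c) * H y" and m = m, OF this]
  have "prim_on (\<lambda>t. \<Sum>y\<in>UNIV. of_real (\<mu> t y) * (exp (of_real t * c) * H y))
    (\<lambda>t. \<Sum>y\<in>UNIV. of_real (\<mu> t y) * (exp (of_real t * c) * (generator (R t) H y + c * H y))) 0 T"
    unfolding \<mu>_def generator_cmult by (simp add: algebra_simps)
  from prim_onD[OF this order_refl T order_refl]
  have "((\<lambda>t. \<Sum>y\<in>UNIV. of_real (\<mu> t y) * (exp (of_real t * c) * (generator (R t) H y + c * H y)))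
      has_integral (\<Sum>y\<in>UNIV. of_real (\<mu> T y) * (exp (of_real T * c) * H y)) -
        (\<Sum>y\<in>UNIV. of_real (\<mu> 0 y) * (exp (of_real 0 * c) * H y))) {0..T}" .
  moreover have "\<mu> T y = \<mu> 0 y" for y
    using m by (simp add: \<mu>_def invariant_distribution_def p_refl)
  ultimately have 1: "((\<lambda>t. \<Sum>y\<in>UNIV. of_real (\<mu> t y) * (exp (of_real t * c) * (generator (R t) H y + c * H y)))
      has_integral 0) {0..T}"
    using c by simp
  have cont: "continuous_on {0..T} (\<lambda>t. \<mu> t y)" for y
    unfolding \<mu>_def by (intro continuous_intros prim_on_continuous[OF prim_on_transition])
  then show f_cont: "continuous_on {0..T} (\<lambda>t. \<Sum>y\<in>UNIV. of_real (\<mu> t y) * f y)"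
    by (intro continuous_intros)
  have "(\<lambda>t. exp (of_real t * c) * (\<Sum>y\<in>UNIV. of_real (\<mu> t y) * f y)) integrable_on {0..T}"
    by (intro integrable_continuous_real continuous_on_mult f_cont) (intro continuous_intros)
  from has_integral_add[OF 1 integrable_integral[OF this]]
  have 2: "((\<lambda>t. (\<Sum>y\<in>UNIV. of_real (\<mu> t y) * (exp (of_real t * c) * (generator (R t) H y + c * H y))) +
      exp (of_real t * c) * (\<Sum>y\<in>UNIV. of_real (\<mu> t y) * f y)) has_integral
      integral {0..T} (\<lambda>t. exp (of_real t * c) * (\<Sum>y\<in>UNIV. of_real (\<mu> t y) * f y))) {0..T}"
    by simp
  \<comment> \<open>In this form \<open>c H + f\<close> equals \<open>- L H\<close>, so adding the
    two integrands leaves only the difference of generators.\<close>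
  have "generator r H y = - f y - c * H y" for y using poisson[of y] by (simp add: algebra_simps)
  then have "(\<Sum>y\<in>UNIV. of_real (\<mu> t y) * (exp (of_real t * c) * (generator (R t) H y + c * H y))) +
      exp (of_real t * c) * (\<Sum>y\<in>UNIV. of_real (\<mu> t y) * f y) =
      exp (of_real t * c) * (\<Sum>y\<in>UNIV. of_real (\<mu> t y) * (generator (R t) H y - generator r H y))" for t
    by (simp add: sum_distrib_left flip: sum.distrib) (simp add: algebra_simps)
  with 2 show "((\<lambda>t. exp (of_real t * c) * (\<Sum>y\<in>UNIV. of_real (\<mu> t y) * (generator (R t) H y - generator r H y)))
    has_integral (integral {0..T} (\<lambda>t. exp (of_real t * c) * (\<Sum>y\<in>UNIV. of_real (\<mu> t y) * f y)))) {0..T}"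
    by simp
qed

end

section \<open>Poisson equation and Duhamel bound\<close>

context stationary_transition
begin

lemma gen_exp_eq_P: "0 \<le> s \<Longrightarrow> gen_exp r c s f x = exp (of_real s * c) * P s f x"
  by (simp add: gen_exp_eq_transition P_def)

context
  fixes f :: "'a \<Rightarrow> complex" and c :: complex
  assumes mean: "(\<Sum>x\<in>UNIV. of_real (\<pi> x) * f x) = 0" and c: "Re c = 0"
begin

text \<open>\<open>exp (t c)\<close> has modulus 1 for imaginary \<open>c\<close>, so the decay
  comes entirely from the mean-zero condition and is available for every frequency, including
  0.\<close>

lemma gen_exp_decay:
  "\<exists>\<alpha>>0. \<exists>C\<ge>0. \<forall>t\<ge>0. \<forall>x. norm (gen_exp r c t f x) \<le> C * exp (- \<alpha> * t)"
  using P_exponential_decay[OF mean] c by (simp add: gen_exp_eq_P norm_mult)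

lemma gen_exp_integrable: "set_integrable lborel {0..} (\<lambda>s. gen_exp r c s f x)"
proof -
  obtain C \<alpha> where *: "0 < \<alpha>" "0 \<le> C" "\<And>t x. 0 \<le> t \<Longrightarrow> norm (gen_exp r c t f x) \<le> C * exp (- \<alpha> * t)"
    using gen_exp_decay by blast
  have "set_integrable lebesgue {0..} (\<lambda>t. exp (- \<alpha> * t))"
    by (intro nonnegative_absolutely_integrable_1 integrable_on_exp_minus_to_infinity *) auto
  then have "set_integrable lborel {0..} (\<lambda>t. exp (- \<alpha> * t))"
    unfolding set_integrable_def by (subst (asm) integrable_completion) auto
  then have "set_integrable lborel {0..} (\<lambda>t. C * exp (- \<alpha> * t))" by simp
  then show ?thesis
  proof (rule set_integrable_bound)
    show "set_borel_measurable lborel {0..} (\<lambda>s. gen_exp r c s f x)"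
      unfolding set_borel_measurable_def using borel_measurable_continuous_onI[OF gen_exp_continuous] by measurable
    show "AE s in lborel. s \<in> {0..} \<longrightarrow> norm (gen_exp r c s f x) \<le> norm (C * exp (- \<alpha> * s))"
      using * by (auto simp: abs_mult)
  qed
qed

text \<open>On \<open>{0..b}\<close> the fundamental theorem gives \<open>(L + c)\<close> applied to
  the truncated integral as the exponential at \<open>b\<close> minus \<open>f\<close>. As
  \<open>b\<close> grows, the exponential decays to 0 and the truncated integrals tend to
  \<open>H\<close>.\<close>

lemma poisson_equation:
  defines "H \<equiv> \<lambda>x. LBINT s:{0..}. gen_exp r c s f x"
  shows "generator r H x + c * H x = - f x"
proof -
  let ?q = "\<lambda>s. gen_exp r c s f"
  let ?I = "\<lambda>b x. LBINT s:{0..b}. ?q s x"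
  have I: "((\<lambda>b. ?I b x) \<longlongrightarrow> H x) at_top" for x
    unfolding H_def by (rule tendsto_set_lebesgue_integral_at_top[OF _ gen_exp_integrable]) auto
  have "((\<lambda>b. generator r (?I b) x + c * ?I b x) \<longlongrightarrow> generator r H x + c * H x) at_top"
    unfolding generator_def by (intro tendsto_intros I)
  moreover have "((\<lambda>b. generator r (?I b) x + c * ?I b x) \<longlongrightarrow> - f x) at_top"
  proof -
    obtain C \<alpha> where *: "0 < \<alpha>" "0 \<le> C" "\<And>t x. 0 \<le> t \<Longrightarrow> norm (?q t x) \<le> C * exp (- \<alpha> * t)"
      using gen_exp_decay by blast
    have "\<forall>\<^sub>F t in at_top. norm (?q t x) \<le> C * exp (- \<alpha> * t)"
      using eventually_ge_at_top[of 0] by (rule eventually_mono) (rule *(3))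
    then have "((\<lambda>t. ?q t x) \<longlongrightarrow> 0) at_top"
      using exp_decay_tendsto_0[OF *(1)] by (rule Lim_null_comparison)
    then have "((\<lambda>b. ?q b x - f x) \<longlongrightarrow> 0 - f x) at_top" by (intro tendsto_intros)
    then have lim: "((\<lambda>b. ?q b x - f x) \<longlongrightarrow> - f x) at_top" by simp
    have eq: "?q b x - f x = generator r (?I b) x + c * ?I b x" if b: "0 \<le> b" for b
    proof -
      have I': "((\<lambda>s. ?q s x) has_integral ?I b x) {0..b}" for x
        using set_borel_integral_eq_integral[OF borel_integrable_atLeastAtMost'[OF gen_exp_continuous, of 0 b r c f x]]
        by (simp add: integrable_integral)
      have "((\<lambda>s. generator r (?q s) x + c * ?q s x) has_integral generator r (?I b) x + c * ?I b x) {0..b}"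
        unfolding generator_def
        by (intro has_integral_add has_integral_sum has_integral_mult_right has_integral_diff I') auto
      from has_integral_unique[OF fundamental_theorem_of_calculus[OF b gen_exp_has_vector_derivative] this]
      show ?thesis by (simp add: gen_exp_0)
    qed
    have "\<forall>\<^sub>F b in at_top. ?q b x - f x = generator r (?I b) x + c * ?I b x"
      using eventually_ge_at_top[of 0] by (rule eventually_mono) (rule eq)
    with lim show ?thesis by (rule Lim_transform_eventually)
  qed
  ultimately show ?thesis by (rule tendsto_unique[OF trivial_limit_at_top_linorder])
qed

end

text \<open>The perturbed law at time \<open>u\<close> paired with the unperturbed semigroup over
  \<open>t - u\<close> interpolates between the two terms. Its integrand contains only the
  difference of the generators, so the rates enter the bound through \<open>\<epsilon>\<close>
  alone.\<close>

lemma duhamel_bound: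
  assumes q: "bounded_transition R q K'" and \<epsilon>: "\<And>s x y. 0 \<le> s \<Longrightarrow> \<bar>R s x y - r x y\<bar> \<le> \<epsilon>"
    and m: "\<And>x. 0 \<le> m x" "(\<Sum>x\<in>UNIV. m x) = 1" and t: "0 \<le> t" and B: "\<And>x. norm (f x) \<le> B"
  shows "norm ((\<Sum>y\<in>UNIV. of_real (\<Sum>x\<in>UNIV. m x * q 0 t x y) * f y) - (\<Sum>x\<in>UNIV. of_real (m x) * P t f x))
    \<le> (real CARD('a) * (\<epsilon> * (2 * B))) * t"
proof -
  interpret q: bounded_transition R q K' by fact
  define \<mu> where "\<mu> u y = (\<Sum>x\<in>UNIV. m x * q 0 u x y)" for u y
  \<comment> \<open>With \<open>c = 0\<close> the exponential is the semigroup \<open>P\<close>, in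
    the form that can be differentiated in time.\<close>
  let ?h = "\<lambda>u. gen_exp r 0 (t - u) f"
  have \<epsilon>0: "0 \<le> \<epsilon>" using \<epsilon>[of 0] by (meson abs_ge_zero order_refl order_trans)
  have B0: "0 \<le> B" using B by (meson norm_ge_zero order_trans)
  have "prim_on (\<lambda>u. ?h u y) (\<lambda>u. - generator r (?h u) y) 0 t" for y
  proof (rule prim_on_vector_derivative)
    fix u :: real
    have "((\<lambda>u. t - u) has_vector_derivative (- 1)) (at u within {0..t})"
      by (auto intro!: derivative_eq_intros)
    from vector_diff_chain_within[OF this gen_exp_has_vector_derivative, of r 0 f y]
    show "((\<lambda>u. ?h u y) has_vector_derivative - generator r (?h u) y) (at u within {0..t})"
      by (simp add: o_def)
  next
    have "continuous_on {0..t} (\<lambda>u. ?h u y)" for y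
      by (rule continuous_on_compose2[OF gen_exp_continuous[of UNIV]]) (auto intro!: continuous_intros)
    then show "continuous_on {0..t} (\<lambda>u. - generator r (?h u) y)"
      unfolding generator_def by (intro continuous_intros)
  qed
  from prim_onD[OF q.prim_on_dynkin[OF this, of m] order_refl t order_refl]
  have "((\<lambda>u. \<Sum>y\<in>UNIV. of_real (\<mu> u y) * (generator (R u) (?h u) y - generator r (?h u) y)) has_integral
    (\<Sum>y\<in>UNIV. of_real (\<mu> t y) * ?h t y) - (\<Sum>y\<in>UNIV. of_real (\<mu> 0 y) * ?h 0 y)) (cbox 0 t)"
    by (simp add: \<mu>_def)
  then have "norm ((\<Sum>y\<in>UNIV. of_real (\<mu> t y) * ?h t y) - (\<Sum>y\<in>UNIV. of_real (\<mu> 0 y) * ?h 0 y))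
    \<le> (real CARD('a) * (\<epsilon> * (2 * B))) * measure lborel (cbox 0 t)"
  proof (rule has_integral_bound[rotated])
    fix u assume "u \<in> cbox 0 t"
    then have u: "0 \<le> u" "u \<le> t" by auto
    have hB: "norm (?h u y) \<le> B" for y
      using P_contraction[of "t - u" f B y, OF _ B] u by (simp add: gen_exp_eq_P)
    have g: "norm (generator (R u) (?h u) y - generator r (?h u) y) \<le> real CARD('a) * (\<epsilon> * (2 * B))" for y
      unfolding generator_rate_diff by (rule generator_norm_bound[OF \<epsilon>[OF u(1)] hB])
    have "norm (\<Sum>y\<in>UNIV. of_real (\<mu> u y) * (generator (R u) (?h u) y - generator r (?h u) y)) \<le>
        (\<Sum>y\<in>UNIV. \<mu> u y * (real CARD('a) * (\<epsilon> * (2 * B))))"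
    proof (rule sum_norm_le)
      fix y
      have "0 \<le> \<mu> u y" unfolding \<mu>_def by (rule q.marginal_distribution[OF m u(1)])
      then show "norm (of_real (\<mu> u y) * (generator (R u) (?h u) y - generator r (?h u) y)) \<le>
          \<mu> u y * (real CARD('a) * (\<epsilon> * (2 * B)))"
        unfolding norm_mult norm_of_real by (intro mult_mono g) auto
    qed
    also have "\<dots> = real CARD('a) * (\<epsilon> * (2 * B))"
      using q.marginal_distribution(2)[OF m u(1)] by (simp add: \<mu>_def flip: sum_distrib_right)
    finally show "norm (\<Sum>y\<in>UNIV. of_real (\<mu> u y) * (generator (R u) (?h u) y - generator r (?h u) y)) \<le>
        real CARD('a) * (\<epsilon> * (2 * B))" .
  qed (use \<epsilon>0 B0 in auto)
  moreover have "\<mu> 0 y = m y" for y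
    by (simp add: \<mu>_def q.p_refl)
  moreover have "?h 0 y = P t f y" for y
    using t by (simp add: gen_exp_eq_P)
  ultimately show ?thesis
    using t unfolding \<mu>_def[symmetric] by (simp add: gen_exp_0)
qed

text \<open>By periodicity \<open>\<mu> t = \<mu> (t + n * T)\<close>. Taking \<open>n\<close> large makes the unperturbed relaxation error
  small, and then a small \<open>\<epsilon>\<close> controls the Duhamel error over the fixed horizon \<open>(n + 1) * T\<close>.\<close>

lemma marginal_close:
  assumes \<eta>: "0 < \<eta>" and T: "0 < T"
  shows "\<exists>\<epsilon>>0. \<forall>R q K' m. bounded_transition R q K' \<longrightarrow> (\<forall>s. R (T + s) = R s) \<longrightarrow>
    (\<forall>s\<ge>0. \<forall>x y. \<bar>R s x y - r x y\<bar> \<le> \<epsilon>) \<longrightarrow> invariant_distribution (q 0 T) m \<longrightarrow>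
    (\<forall>t\<in>{0..T}. \<bar>(\<Sum>x\<in>UNIV. m x * q 0 t x y) - \<pi> y\<bar> \<le> \<eta>)"
proof -
  \<comment> \<open>The centred indicator of \<open>y\<close>: a probability vector paired with it
    gives its deviation from \<open>\<pi> y\<close>.\<close>
  define f where "f z = complex_of_real (of_bool (z = y) - \<pi> y)" for z
  have mean: "(\<Sum>x\<in>UNIV. of_real (\<pi> x) * f x) = 0"
    using \<pi>_sum unfolding f_def
    by (simp add: right_diff_distrib sum_subtractf flip: of_real_mult of_real_sum of_real_diff sum_distrib_right)
  have "\<pi> y \<le> 1" using member_le_sum[of y UNIV \<pi>] \<pi>_sum \<pi>_nonneg by auto
  then have B: "norm (f z) \<le> 1" for z
    using \<pi>_nonneg[of y] unfolding f_def norm_of_real by auto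
  obtain C \<alpha> where *: "0 < \<alpha>" "0 \<le> C" "\<And>t x. 0 \<le> t \<Longrightarrow> norm (P t f x) \<le> C * exp (- \<alpha> * t)"
    using P_exponential_decay[OF mean] by blast
  have "\<forall>\<^sub>F t in at_top. C * exp (- \<alpha> * t) < \<eta> / 2"
    by (rule order_tendstoD(2)[OF exp_decay_tendsto_0[OF *(1)]]) (use \<eta> in simp)
  then obtain t0 where t0: "\<And>t. t0 \<le> t \<Longrightarrow> C * exp (- \<alpha> * t) < \<eta> / 2"
    by (auto simp: eventually_at_top_linorder)
  obtain n where n: "t0 \<le> real n * T"
    using reals_Archimedean3[OF T] by (meson less_imp_le)
  \<comment> \<open>The factor of \<open>\<epsilon>\<close> in the Duhamel bound with
    \<open>B = 1\<close> at the longest time \<open>T + n T\<close>; hence the choice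
    \<open>\<eta> / 2 / L\<close> below.\<close>
  define L where "L = real CARD('a) * 2 * (T + real n * T)"
  have L: "0 < L" unfolding L_def using T by (simp add: add_pos_nonneg)
  show ?thesis
  proof (intro exI[of _ "\<eta> / 2 / L"] conjI allI impI ballI)
    fix R q K' m t
    assume q: "bounded_transition R q K'" and per: "\<forall>s. R (T + s) = R s"
      and \<epsilon>: "\<forall>s\<ge>0. \<forall>x y. \<bar>R s x y - r x y\<bar> \<le> \<eta> / 2 / L"
      and m: "invariant_distribution (q 0 T) m" and t: "t \<in> {0..T}"
    interpret q: bounded_transition R q K' by fact
    have m': "0 \<le> m x" "(\<Sum>x\<in>UNIV. m x) = 1" for x
      using m by (auto simp: invariant_distribution_def)
    let ?t = "t + real n * T"
    have t': "0 \<le> ?t" "t0 \<le> ?t" "?t \<le> T + real n * T" using t T n by auto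
    define \<mu> where "\<mu> y = (\<Sum>x\<in>UNIV. m x * q 0 t x y)" for y
    have \<mu>: "(\<Sum>x\<in>UNIV. m x * q 0 ?t x y) = \<mu> y" for y
      unfolding \<mu>_def using q.periodic_marginal[OF _ _ m, of t n y] per t T by auto
    have "norm ((\<Sum>y\<in>UNIV. of_real (\<Sum>x\<in>UNIV. m x * q 0 ?t x y) * f y) - (\<Sum>x\<in>UNIV. of_real (m x) * P ?t f x))
        \<le> (real CARD('a) * (\<eta> / 2 / L * (2 * 1))) * ?t"
      by (rule duhamel_bound[OF q _ m' t'(1) B]) (use \<epsilon> in auto)
    also have "\<dots> \<le> (real CARD('a) * (\<eta> / 2 / L * (2 * 1))) * (T + real n * T)"
      using t'(3) L \<eta> by (intro mult_left_mono) auto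
    also have "\<dots> = \<eta> / 2" using L by (simp add: L_def field_simps)
    finally have 1: "norm ((\<Sum>y\<in>UNIV. of_real (\<mu> y) * f y) - (\<Sum>x\<in>UNIV. of_real (m x) * P ?t f x)) \<le> \<eta> / 2"
      unfolding \<mu> .
    have "norm (\<Sum>x\<in>UNIV. of_real (m x) * P ?t f x) \<le> (\<Sum>x\<in>UNIV. m x * (\<eta> / 2))"
    proof (rule sum_norm_le)
      fix x
      have "norm (P ?t f x) \<le> \<eta> / 2" using *(3)[OF t'(1), of x] t0[OF t'(2)] by linarith
      then have "m x * norm (P ?t f x) \<le> m x * (\<eta> / 2)"
        using m'(1)[of x] by (rule mult_left_mono)
      then show "norm (of_real (m x) * P ?t f x) \<le> m x * (\<eta> / 2)"
        using m'(1)[of x] by (simp add: norm_mult)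
    qed
    also have "\<dots> = \<eta> / 2" using m' by (simp flip: sum_distrib_right sum_divide_distrib)
    finally have "norm (\<Sum>y\<in>UNIV. of_real (\<mu> y) * f y) \<le> \<eta> / 2 + \<eta> / 2"
      using 1 by (intro order_trans[OF norm_triangle_sub add_mono])
    moreover have "(\<Sum>y\<in>UNIV. of_real (\<mu> y) * f y) = complex_of_real (\<mu> y - \<pi> y)"
    proof -
      have "(\<Sum>z\<in>UNIV. \<mu> z * (of_bool (z = y) - \<pi> y)) = \<mu> y - (\<Sum>z\<in>UNIV. \<mu> z) * \<pi> y"
        by (simp add: right_diff_distrib sum_subtractf sum_distrib_right)
      also have "(\<Sum>z\<in>UNIV. \<mu> z) = 1"
        unfolding \<mu>_def using q.marginal_distribution(2)[OF m', of t] t by auto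
      finally show ?thesis
        unfolding f_def of_real_mult[symmetric] of_real_sum[symmetric] by simp
    qed
    ultimately have "norm (complex_of_real (\<mu> y - \<pi> y)) \<le> \<eta> / 2 + \<eta> / 2" by (simp only:)
    then show "\<bar>(\<Sum>x\<in>UNIV. m x * q 0 t x y) - \<pi> y\<bar> \<le> \<eta>"
      unfolding norm_of_real \<mu>_def by simp
  qed (use \<eta> L in auto)
qed

end

section \<open>Two-time expectations of a jump process\<close>

lemma markov_jump_process_expectation:
  fixes h :: "'a::finite \<Rightarrow> 'a \<Rightarrow> 'b::{banach, second_countable_topology}"
  assumes X: "markov_jump_process M X \<mu> p" and t: "0 \<le> t"
  shows "(\<integral>w. h (X 0 w) (X t w) \<partial>M) = (\<Sum>x\<in>UNIV. \<Sum>y\<in>UNIV. (\<mu> x * p 0 t x y) *\<^sub>R h x y)"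
proof -
  interpret prob_space M using X by (simp add: markov_jump_process_def)
  have [measurable]: "X 0 \<in> measurable M (count_space UNIV)" "X t \<in> measurable M (count_space UNIV)"
    using X t by (auto simp: markov_jump_process_def)
  let ?A = "\<lambda>x y. {w \<in> space M. X 0 w = x \<and> X t w = y}"
  have prob: "measure M (?A x y) = \<mu> x * p 0 t x y" for x y
  proof -
    \<comment> \<open>The finite-dimensional law is used with a single increment; the time and state
      sequences continue as constants beyond index 1.\<close>
    have "measure M {w \<in> space M. \<forall>i\<le>1::nat. X (if i = 0 then 0 else t) w = (if i = 0 then x else y)} =
       \<mu> x * p 0 t x y"
      using X t unfolding markov_jump_process_def
      by (elim conjE allE[of _ "1::nat"] allE[of _ "\<lambda>i. if i = (0::nat) then 0 else t"]
          allE[of _ "\<lambda>i. if i = (0::nat) then x else y"]) simp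
    moreover have "{w \<in> space M. \<forall>i\<le>1::nat. X (if i = 0 then 0 else t) w = (if i = 0 then x else y)} = ?A x y"
      by (auto simp: le_Suc_eq)
    ultimately show ?thesis by (simp only:)
  qed
  have "(\<integral>w. h (X 0 w) (X t w) \<partial>M) = (\<integral>w. (\<Sum>x\<in>UNIV. \<Sum>y\<in>UNIV. indicator (?A x y) w *\<^sub>R h x y) \<partial>M)"
  proof (rule Bochner_Integration.integral_cong[OF refl])
    fix w assume w: "w \<in> space M"
    have "(\<Sum>x\<in>UNIV. \<Sum>y\<in>UNIV. indicator (?A x y) w *\<^sub>R h x y) =
        (\<Sum>x\<in>UNIV. \<Sum>y\<in>UNIV. if X 0 w = x then (if X t w = y then h x y else 0) else 0)"
      using w by (intro sum.cong refl) (auto simp: indicator_def)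
    also have "\<dots> = (\<Sum>x\<in>UNIV. if X 0 w = x then h x (X t w) else 0)"
      by (intro sum.cong refl) auto
    also have "\<dots> = h (X 0 w) (X t w)" by simp
    finally show "h (X 0 w) (X t w) = (\<Sum>x\<in>UNIV. \<Sum>y\<in>UNIV. indicator (?A x y) w *\<^sub>R h x y)" by simp
  qed
  also have "\<dots> = (\<Sum>x\<in>UNIV. \<Sum>y\<in>UNIV. measure M (?A x y) *\<^sub>R h x y)"
  proof -
    have A: "?A x y \<in> sets M" for x y by measurable
    then have ind: "integrable M (indicat_real (?A x y))" for x y
      by (rule integrable_real_indicator) (simp add: emeasure_eq_measure)
    then have int: "integrable M (\<lambda>w. indicator (?A x y) w *\<^sub>R h x y)" for x y
      by simp
    have "(\<integral>w. indicator (?A x y) w *\<^sub>R h x y \<partial>M) = measure M (?A x y) *\<^sub>R h x y" for x y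
      using ind[of x y] A[of x y] by simp
    then show ?thesis
      by (simp only: Bochner_Integration.integral_sum Bochner_Integration.integrable_sum int)
  qed
  finally show ?thesis unfolding prob .
qed

section \<open>Linear response\<close>

lemma exp_first_order:
  fixes e :: real
  assumes "0 < e"
  shows "\<exists>d>0. \<forall>y::real. \<bar>y\<bar> < d \<longrightarrow> \<bar>exp y - 1 - y\<bar> \<le> e * \<bar>y\<bar>"
proof -
  have "(*) (1::real) = (\<lambda>y. y)" by auto
  then have "((exp :: real \<Rightarrow> real) has_derivative (\<lambda>y. y)) (at 0)"
    using DERIV_exp[of "0::real"] by (simp add: has_field_derivative_def)
  then show ?thesis using assms by (simp add: has_derivative_at_alt)
qed

lemma eventually_small: "0 < d \<Longrightarrow> \<forall>\<^sub>F l::real in at 0. \<bar>l\<bar> < d"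
  by (auto simp: eventually_at intro!: exI[of _ d])

text \<open>Boundedness of \<open>g\<close> keeps \<open>l * g\<close> small uniformly in time and
  states, so one neighbourhood of 0 serves all of them.\<close>

lemma perturbed_rate_first_order:
  fixes g :: "real \<Rightarrow> 'a \<Rightarrow> 'a \<Rightarrow> real"
  assumes g: "\<And>s x y. \<bar>g s x y\<bar> \<le> C" and r: "\<And>x y. \<bar>r x y\<bar> \<le> K" and \<eta>: "0 < \<eta>"
  shows "\<forall>\<^sub>F l in at 0. \<forall>s x y. \<bar>perturbed_rate g r l s x y - r x y - l * (r x y * g s x y)\<bar> \<le> \<bar>l\<bar> * \<eta>"
proof -
  have C: "0 \<le> C" and K: "0 \<le> K" using g r by (meson abs_ge_zero order_trans)+
  \<comment> \<open>The remainder is at most \<open>\<bar>l\<bar> * e * K * C\<close>. The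
    \<open>+ 1\<close> here, and in \<open>d / (C + 1)\<close> below, avoids division by
    zero.\<close>
  define e where "e = \<eta> / (K * C + 1)"
  have "0 < e" using \<eta> C K by (simp add: e_def add_nonneg_pos)
  from exp_first_order[OF this] obtain d where
    d: "0 < d" "\<And>y::real. \<bar>y\<bar> < d \<Longrightarrow> \<bar>exp y - 1 - y\<bar> \<le> e * \<bar>y\<bar>" by blast
  have "\<forall>\<^sub>F l::real in at 0. \<bar>l\<bar> < d / (C + 1)"
    by (rule eventually_small) (use d C in simp)
  then show ?thesis
  proof (rule eventually_mono, intro allI)
    fix l :: real and s x y
    assume l: "\<bar>l\<bar> < d / (C + 1)"
    have lg: "\<bar>l * g s x y\<bar> \<le> \<bar>l\<bar> * C" unfolding abs_mult by (intro mult_left_mono g) auto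
    also have "\<dots> \<le> \<bar>l\<bar> * (C + 1)" by (intro mult_left_mono) auto
    also have "\<dots> < d" using l C by (simp add: field_simps)
    finally have "\<bar>exp (l * g s x y) - 1 - l * g s x y\<bar> \<le> e * \<bar>l * g s x y\<bar>" by (rule d(2))
    also have "\<dots> \<le> e * (\<bar>l\<bar> * C)" using lg \<open>0 < e\<close> by (intro mult_left_mono) auto
    finally have "\<bar>r x y\<bar> * \<bar>exp (l * g s x y) - 1 - l * g s x y\<bar> \<le> K * (e * (\<bar>l\<bar> * C))"
      by (intro mult_mono r) (use K in auto)
    also have "\<dots> = \<bar>l\<bar> * (e * (K * C))" by simp
    also have "\<dots> \<le> \<bar>l\<bar> * (e * (K * C + 1))"
      using \<open>0 < e\<close> by (intro mult_left_mono) auto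
    also have "e * (K * C + 1) = \<eta>"
      using C K by (simp add: e_def add_nonneg_eq_0_iff)
    finally show "\<bar>perturbed_rate g r l s x y - r x y - l * (r x y * g s x y)\<bar> \<le> \<bar>l\<bar> * \<eta>"
      unfolding perturbed_rate_def abs_mult[symmetric] by (simp add: algebra_simps)
  qed
qed

lemma perturbed_rate_close:
  fixes g :: "real \<Rightarrow> 'a \<Rightarrow> 'a \<Rightarrow> real"
  assumes g: "\<And>s x y. \<bar>g s x y\<bar> \<le> C" and r: "\<And>x y. \<bar>r x y\<bar> \<le> K" and \<eta>: "0 < \<eta>"
  shows "\<forall>\<^sub>F l in at 0. \<forall>s x y. \<bar>perturbed_rate g r l s x y - r x y\<bar> \<le> \<eta>"
proof -
  have C: "0 \<le> C" and K: "0 \<le> K" using g r by (meson abs_ge_zero order_trans)+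
  have "\<forall>\<^sub>F l::real in at 0. \<bar>l\<bar> < \<eta> / (1 + K * C)"
    by (rule eventually_small) (use \<eta> C K in \<open>simp add: add_pos_nonneg\<close>)
  with perturbed_rate_first_order[OF g r zero_less_one] show ?thesis
  proof (rule eventually_elim2, intro allI)
    fix l :: real and s x y
    assume 1: "\<forall>s x y. \<bar>perturbed_rate g r l s x y - r x y - l * (r x y * g s x y)\<bar> \<le> \<bar>l\<bar> * 1"
      and l: "\<bar>l\<bar> < \<eta> / (1 + K * C)"
    have "\<bar>l * (r x y * g s x y)\<bar> \<le> \<bar>l\<bar> * (K * C)"
      unfolding abs_mult by (intro mult_left_mono mult_mono g r) (use K in auto)
    then have "\<bar>perturbed_rate g r l s x y - r x y\<bar> \<le> \<bar>l\<bar> * 1 + \<bar>l\<bar> * (K * C)"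
      using 1[rule_format, of s x y] by linarith
    also have "\<dots> = \<bar>l\<bar> * (1 + K * C)" by (simp add: algebra_simps)
    also have "\<dots> \<le> \<eta>" using l C K by (simp add: field_simps add_pos_nonneg)
    finally show "\<bar>perturbed_rate g r l s x y - r x y\<bar> \<le> \<eta>" .
  qed
qed

context stationary_transition
begin

lemma P_const: "0 \<le> t \<Longrightarrow> P t (\<lambda>y. a) x = a"
  using p_sum[of 0 t x] by (simp add: P_def flip: sum_distrib_right of_real_sum)

lemma P_shift_const: "0 \<le> t \<Longrightarrow> P t (\<lambda>y. f y - a) x = P t f x - a"
  using P_const[of t a x] by (simp add: P_def right_diff_distrib sum_subtractf)

text \<open>The vector \<open>\<pi> * psi\<close> is the forward image of \<open>\<pi>\<close> under
  the signed rates \<open>r * g\<close>: \<open>reversed_rate\<close> encodes the inflow divided by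
  \<open>\<pi>\<close>, and the subtracted term is the outflow.\<close>

lemma psi_duality:
  "(\<Sum>y\<in>UNIV. of_real (\<pi> y) * generator (\<lambda>x z. r x z * g t x z) H y) =
    (\<Sum>y\<in>UNIV. of_real (\<pi> y) * of_real (psi \<pi> r g t y) * H y)"
proof -
  have "(\<Sum>z\<in>UNIV. \<pi> z * (r z y * g t z y)) - \<pi> y * (\<Sum>z\<in>UNIV. r y z * g t y z) = \<pi> y * psi \<pi> r g t y" for y
    using \<pi>_pos[of y]
    by (simp add: psi_def reversed_rate_def sum_subtractf right_diff_distrib sum_distrib_left mult.assoc)
  then show ?thesis
    unfolding forward_backward_duality[symmetric] by (simp flip: of_real_mult)
qed

lemma psi_fourier:
  assumes T: "0 < T" and g: "\<And>s x y. \<bar>g s x y\<bar> \<le> C"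
    and meas: "\<And>x y. (\<lambda>s. g s x y) \<in> borel_measurable borel"
  shows "((\<lambda>t. exp (- \<i> * of_int k * of_real (2 * pi / T) * of_real t) * of_real (psi \<pi> r g t y))
    has_integral (of_real T * psi_hat \<pi> r g T k y)) {0..T}"
proof -
  let ?f = "\<lambda>t. exp (- \<i> * of_int k * of_real (2 * pi / T) * of_real t) * of_real (psi \<pi> r g t y)"
  define B where "B = (\<Sum>z\<in>UNIV. \<bar>reversed_rate \<pi> r y z\<bar> * C + \<bar>r y z\<bar> * C)"
  have "\<bar>psi \<pi> r g t y\<bar> \<le> B" for t
    unfolding psi_def B_def
    by (rule order_trans[OF sum_abs], rule sum_mono, rule order_trans[OF abs_triangle_ineq4])
      (auto simp: abs_mult intro!: add_mono mult_left_mono g)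
  then have "norm (?f t) \<le> B" for t by (simp add: norm_mult)
  moreover have "(\<lambda>t. psi \<pi> r g t y) \<in> borel_measurable borel"
    unfolding psi_def using meas by measurable
  then have "?f \<in> borel_measurable lborel" by measurable
  ultimately have "set_integrable lborel {0..T} ?f"
    unfolding set_integrable_def by (intro integrableI_bounded_set_indicator[of _ _ _ B]) (use T in auto)
  from set_borel_integral_eq_integral[OF this] show ?thesis
    using T by (simp add: psi_hat_def fourier_coeff_def has_integral_integral)
qed

text \<open>The generator kills constants, so duality with \<open>H = 1\<close> gives mean zero for
  \<open>psi\<close> at every time, hence for its Fourier coefficients. This is why centring
  \<open>v\<close> leaves the response integrals unchanged.\<close>

lemma psi_hat_mean:
  assumes T: "0 < T" and g: "\<And>s x y. \<bar>g s x y\<bar> \<le> C"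
    and meas: "\<And>x y. (\<lambda>s. g s x y) \<in> borel_measurable borel"
  shows "(\<Sum>y\<in>UNIV. of_real (\<pi> y) * psi_hat \<pi> r g T k y) = 0"
proof -
  let ?e = "\<lambda>t. exp (- \<i> * of_int k * of_real (2 * pi / T) * of_real t)"
  have 1: "((\<lambda>t. \<Sum>y\<in>UNIV. of_real (\<pi> y) * (?e t * of_real (psi \<pi> r g t y))) has_integral
      (\<Sum>y\<in>UNIV. of_real (\<pi> y) * (of_real T * psi_hat \<pi> r g T k y))) {0..T}"
    by (intro has_integral_sum has_integral_mult_right psi_fourier[OF T g meas]) auto
  have "(\<Sum>y\<in>UNIV. of_real (\<pi> y) * (?e t * of_real (psi \<pi> r g t y))) = 0" for t
  proof -
    have "(\<Sum>y\<in>UNIV. of_real (\<pi> y) * (?e t * of_real (psi \<pi> r g t y))) =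
        ?e t * (\<Sum>y\<in>UNIV. of_real (\<pi> y) * of_real (psi \<pi> r g t y) * 1)"
      unfolding sum_distrib_left by (simp only: mult_ac mult_1_left)
    also have "\<dots> = 0" unfolding psi_duality[symmetric] by (simp add: generator_const)
    finally show ?thesis .
  qed
  then have "(\<Sum>y\<in>UNIV. of_real (\<pi> y) * (of_real T * psi_hat \<pi> r g T k y)) = 0"
    using has_integral_unique[OF 1] by simp
  then have "of_real T * (\<Sum>y\<in>UNIV. of_real (\<pi> y) * psi_hat \<pi> r g T k y) = 0"
    by (simp add: sum_distrib_left mult_ac)
  then show ?thesis using T by simp
qed

text \<open>\<open>marginal_close\<close> fixes \<open>\<epsilon>\<close> before the rates are
  chosen, so a single neighbourhood of \<open>l = 0\<close> works for all times of a period.\<close>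

lemma marginal_convergence:
  assumes T: "0 < T" and g: "\<And>s x y. \<bar>g s x y\<bar> \<le> C"
    and per: "\<And>s x y. g (s + T) x y = g s x y"
    and pl: "\<And>l. bounded_transition (perturbed_rate g r l) (pl l) (Kl l)"
    and \<pi>l: "\<And>l. invariant_distribution (pl l 0 T) (\<pi>l l)" and \<eta>: "0 < \<eta>"
  shows "\<forall>\<^sub>F l in at 0. \<forall>t\<in>{0..T}. \<bar>(\<Sum>x\<in>UNIV. \<pi>l l x * pl l 0 t x y) - \<pi> y\<bar> \<le> \<eta>"
proof -
  obtain \<epsilon> where \<epsilon>: "0 < \<epsilon>" and *: "\<forall>R q K' m. bounded_transition R q K' \<longrightarrow> (\<forall>s. R (T + s) = R s) \<longrightarrow>
      (\<forall>s\<ge>0. \<forall>x y. \<bar>R s x y - r x y\<bar> \<le> \<epsilon>) \<longrightarrow> invariant_distribution (q 0 T) m \<longrightarrow>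
      (\<forall>t\<in>{0..T}. \<bar>(\<Sum>x\<in>UNIV. m x * q 0 t x y) - \<pi> y\<bar> \<le> \<eta>)"
    using marginal_close[OF \<eta> T] by blast
  have r: "\<bar>r x y\<bar> \<le> K" for x y using rate_bound[of 0 x y] by simp
  from perturbed_rate_close[OF g r \<epsilon>] show ?thesis
  proof (rule eventually_mono)
    fix l assume l: "\<forall>s x y. \<bar>perturbed_rate g r l s x y - r x y\<bar> \<le> \<epsilon>"
    have "perturbed_rate g r l (T + s) = perturbed_rate g r l s" for s
      using per[of s] by (simp add: perturbed_rate_def fun_eq_iff add.commute)
    then show "\<forall>t\<in>{0..T}. \<bar>(\<Sum>x\<in>UNIV. \<pi>l l x * pl l 0 t x y) - \<pi> y\<bar> \<le> \<eta>"
      using *[rule_format, OF pl[of l] _ _ \<pi>l[of l]] l by blast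
  qed
qed

lemma response_derivative:
  fixes g :: "real \<Rightarrow> 'a \<Rightarrow> 'a \<Rightarrow> real" and v :: "'a \<Rightarrow> real" and k :: int
  assumes T: "0 < T" and g: "\<And>s x y. \<bar>g s x y\<bar> \<le> C"
    and meas: "\<And>x y. (\<lambda>s. g s x y) \<in> borel_measurable borel"
    and per: "\<And>s x y. g (s + T) x y = g s x y"
    and pl: "\<And>l. bounded_transition (perturbed_rate g r l) (pl l) (Kl l)"
    and \<pi>l: "\<And>l. invariant_distribution (pl l 0 T) (\<pi>l l)"
  defines "c \<equiv> - \<i> * of_int k * of_real (2 * pi / T)"
    and "f \<equiv> \<lambda>y. of_real (v y) - (\<Sum>x\<in>UNIV. of_real (\<pi> x) * of_real (v x))"
  shows "((\<lambda>l. fourier_coeff T k (\<lambda>t. of_real (\<Sum>y\<in>UNIV. (\<Sum>x\<in>UNIV. \<pi>l l x * pl l 0 t x y) * v y)))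
    has_vector_derivative
      (\<Sum>y\<in>UNIV. of_real (\<pi> y) * psi_hat \<pi> r g T k y * (LBINT s:{0..}. gen_exp r c s f y))) (at 0)"
proof -
  define H where "H y = (LBINT s:{0..}. gen_exp r c s f y)" for y
  define D where "D = (\<Sum>y\<in>UNIV. of_real (\<pi> y) * psi_hat \<pi> r g T k y * H y)"
  define e where "e t = exp (of_real t * c)" for t
  define vbar where "vbar = (\<Sum>x\<in>UNIV. complex_of_real (\<pi> x) * of_real (v x))"
  define \<mu> where "\<mu> l t y = (\<Sum>x\<in>UNIV. \<pi>l l x * pl l 0 t x y)" for l t y
  define J where "J l = integral {0..T} (\<lambda>t. e t * (\<Sum>y\<in>UNIV. of_real (\<mu> l t y) * f y))" for l
  define \<Phi> where "\<Phi> l = fourier_coeff T k (\<lambda>t. of_real (\<Sum>y\<in>UNIV. \<mu> l t y * v y))" for l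
  have f: "f y = of_real (v y) - vbar" for y by (simp add: f_def vbar_def)
  have r: "\<bar>r x y\<bar> \<le> K" for x y using rate_bound[of 0 x y] by simp
  have \<pi>l': "0 \<le> \<pi>l l x" "(\<Sum>x\<in>UNIV. \<pi>l l x) = 1" for l x
    using \<pi>l[of l] by (auto simp: invariant_distribution_def)
  have Re_c: "Re c = 0" by (simp add: c_def)
  have norm_e: "norm (e t) = 1" for t using Re_c by (simp add: e_def)
  have e_T: "e T = 1"
  proof -
    have "of_real T * c = - (2 * of_int k * of_real pi * \<i>)"
      using T by (simp add: c_def field_simps)
    then show ?thesis by (simp add: e_def exp_minus exp_integer_2pi mult_ac)
  qed
  have mean: "(\<Sum>x\<in>UNIV. of_real (\<pi> x) * f x) = 0"
  proof -
    have "(\<Sum>x\<in>UNIV. of_real (\<pi> x) * f x) = vbar - of_real (\<Sum>x\<in>UNIV. \<pi> x) * vbar"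
      unfolding f by (simp add: right_diff_distrib sum_subtractf vbar_def sum_distrib_right)
    then show ?thesis by (simp add: \<pi>_sum)
  qed
  have poisson: "generator r H y + c * H y = - f y" for y
    unfolding H_def by (rule poisson_equation[OF mean Re_c])
  have bal: "((\<lambda>t. e t * (\<Sum>y\<in>UNIV. of_real (\<mu> l t y) *
        (generator (perturbed_rate g r l t) H y - generator r H y))) has_integral J l) {0..T}" for l
    unfolding J_def \<mu>_def e_def
    by (rule bounded_transition.fourier_balance(1)[OF pl _ \<pi>l _ poisson]) (use T e_T in \<open>auto simp: e_def\<close>)
  have cont: "continuous_on {0..T} (\<lambda>t. \<Sum>y\<in>UNIV. of_real (\<mu> l t y) * f y)" for l
    unfolding \<mu>_def
    by (rule bounded_transition.fourier_balance(2)[OF pl _ \<pi>l _ poisson]) (use T e_T in \<open>auto simp: e_def\<close>)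
  have "perturbed_rate g r 0 t = r" for t by (auto simp: perturbed_rate_def fun_eq_iff)
  \<comment> \<open>At \<open>l = 0\<close> the difference of generators, hence the balance
    integrand, vanishes.\<close>
  then have J0: "J 0 = 0" using has_integral_unique[OF bal[of 0]] by simp
  have cont_e: "continuous_on S e" for S unfolding e_def by (intro continuous_intros)
  \<comment> \<open>Writing \<open>v\<close> as \<open>f + vbar\<close> and using unit mass of the
    marginals isolates a constant that does not depend on \<open>l\<close>; only \<open>J\<close>
    has to be differentiated.\<close>
  have \<Phi>: "\<Phi> l = 1 / of_real T * (J l + integral {0..T} e * vbar)" for l
  proof -
    have int1: "(\<lambda>t. e t * (\<Sum>y\<in>UNIV. of_real (\<mu> l t y) * f y)) integrable_on {0..T}"
      by (intro integrable_continuous_real continuous_on_mult cont cont_e)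
    have int2: "(\<lambda>t. e t * vbar) integrable_on {0..T}"
      by (intro integrable_continuous_real continuous_intros cont_e)
    let ?w = "\<lambda>t. e t * (\<Sum>y\<in>UNIV. of_real (\<mu> l t y) * f y) + e t * vbar"
    have eq: "exp (- \<i> * of_int k * of_real (2 * pi / T) * of_real t) * of_real (\<Sum>y\<in>UNIV. \<mu> l t y * v y) = ?w t"
      if "t \<in> {0..T}" for t
    proof -
      have "(\<Sum>y\<in>UNIV. \<mu> l t y) = 1"
        unfolding \<mu>_def using bounded_transition.marginal_distribution(2)[OF pl \<pi>l'] that by simp
      then have "(\<Sum>y\<in>UNIV. complex_of_real (\<mu> l t y)) = 1" by (simp flip: of_real_sum)
      then have "of_real (\<Sum>y\<in>UNIV. \<mu> l t y * v y) = (\<Sum>y\<in>UNIV. of_real (\<mu> l t y) * f y) + vbar"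
        by (simp add: f right_diff_distrib sum_subtractf flip: sum_distrib_right)
      moreover have "exp (- \<i> * of_int k * of_real (2 * pi / T) * of_real t) = e t"
        unfolding e_def c_def by (simp only: mult.commute)
      ultimately show ?thesis by (simp only: distrib_left)
    qed
    have "\<Phi> l = 1 / of_real T * (LBINT t:{0..T}. ?w t)"
      unfolding \<Phi>_def fourier_coeff_def
      by (intro arg_cong[where f = "\<lambda>x. 1 / of_real T * x"] set_lebesgue_integral_cong) (use eq in auto)
    also have "(LBINT t:{0..T}. ?w t) = integral {0..T} ?w"
      by (intro set_borel_integral_eq_integral borel_integrable_atLeastAtMost' continuous_intros cont cont_e)
    also have "\<dots> = J l + integral {0..T} e * vbar"
      unfolding J_def by (simp add: Henstock_Kurzweil_Integration.integral_add[OF int1 int2])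
    finally show ?thesis .
  qed
  have \<Phi>_diff: "\<Phi> l - \<Phi> 0 = J l / of_real T" for l
    unfolding \<Phi> J0 by (simp add: add_divide_distrib)
  \<comment> \<open>The coefficient of \<open>l\<close> in the difference of generators applied to
    \<open>H\<close>.\<close>
  define G where "G t y = generator (\<lambda>x z. r x z * g t x z) H y" for t y
  define BH where "BH = (\<Sum>y\<in>UNIV. norm (H y))"
  have BH: "norm (H y) \<le> BH" for y
    unfolding BH_def by (rule member_le_sum[where f = "\<lambda>x. norm (H x)"]) auto
  have BH0: "0 \<le> BH" unfolding BH_def by (rule sum_nonneg) auto
  define N where "N = real CARD('a)"
  have N: "0 < N" by (simp add: N_def)
  define BG where "BG = N * ((K * C) * (2 * BH))"
  have C: "0 \<le> C" and K: "0 \<le> K" using g r by (meson abs_ge_zero order_trans)+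
  have BG: "norm (G t y) \<le> BG" for t y
    unfolding G_def BG_def N_def
    by (rule generator_norm_bound[OF _ BH]) (unfold abs_mult, intro mult_mono r g, use K in auto)
  have BG0: "0 \<le> BG" unfolding BG_def using N K C BH0 by simp
  have S: "((\<lambda>t. e t * (\<Sum>y\<in>UNIV. of_real (\<pi> y) * G t y)) has_integral (of_real T * D)) {0..T}"
  proof -
    have "((\<lambda>t. \<Sum>y\<in>UNIV. of_real (\<pi> y) * H y *
          (exp (- \<i> * of_int k * of_real (2 * pi / T) * of_real t) * of_real (psi \<pi> r g t y)))
        has_integral (\<Sum>y\<in>UNIV. of_real (\<pi> y) * H y * (of_real T * psi_hat \<pi> r g T k y))) {0..T}"
      by (intro has_integral_sum has_integral_mult_right psi_fourier[OF T g meas]) auto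
    moreover have "(\<Sum>y\<in>UNIV. of_real (\<pi> y) * H y * (of_real T * psi_hat \<pi> r g T k y)) = of_real T * D"
      unfolding D_def sum_distrib_left by (simp add: mult_ac)
    moreover have "(\<Sum>y\<in>UNIV. of_real (\<pi> y) * H y *
          (exp (- \<i> * of_int k * of_real (2 * pi / T) * of_real t) * of_real (psi \<pi> r g t y))) =
        e t * (\<Sum>y\<in>UNIV. of_real (\<pi> y) * G t y)" for t
    proof -
      have "exp (- \<i> * of_int k * of_real (2 * pi / T) * of_real t) = e t"
        unfolding e_def c_def by (simp only: mult.commute)
      then show ?thesis unfolding G_def psi_duality sum_distrib_left by (simp only: mult_ac)
    qed
    ultimately show ?thesis by (simp only:)
  qed
  have main: "\<forall>\<^sub>F l in at 0. norm (J l - of_real l * (of_real T * D)) \<le> \<bar>l\<bar> * \<eta>" if \<eta>: "0 < \<eta>" for \<eta>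
  proof -
    define A where "A = N * (2 * BH) + BG"
    \<comment> \<open>Integrating \<open>N * A\<close> times the tolerance over a period must stay
      below \<open>\<eta>\<close>. \<open>A\<close> adds the constants of the rate remainder and of
      the marginal error; \<open>A + 1\<close> avoids a zero divisor.\<close>
    define \<eta>' where "\<eta>' = \<eta> / (N * (A + 1) * T)"
    have A: "0 \<le> A" unfolding A_def using N BH0 BG0 by simp
    have \<eta>': "0 < \<eta>'" unfolding \<eta>'_def using \<eta> N A T by simp
    have "\<forall>\<^sub>F l in at 0. \<forall>y\<in>UNIV. \<forall>t\<in>{0..T}. \<bar>\<mu> l t y - \<pi> y\<bar> \<le> \<eta>'"
      unfolding \<mu>_def
      by (intro eventually_ball_finite ballI marginal_convergence[OF T g per pl \<pi>l \<eta>']) auto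
    with perturbed_rate_first_order[OF g r \<eta>'] show ?thesis
    proof (rule eventually_elim2)
      fix l
      assume 1: "\<forall>s x y. \<bar>perturbed_rate g r l s x y - r x y - l * (r x y * g s x y)\<bar> \<le> \<bar>l\<bar> * \<eta>'"
        and 2: "\<forall>y\<in>UNIV. \<forall>t\<in>{0..T}. \<bar>\<mu> l t y - \<pi> y\<bar> \<le> \<eta>'"
      let ?d = "\<lambda>t y. generator (perturbed_rate g r l t) H y - generator r H y"
      have d: "norm (?d t y - of_real l * G t y) \<le> N * ((\<bar>l\<bar> * \<eta>') * (2 * BH))" for t y
        unfolding G_def generator_rate_cmult generator_rate_diff N_def
        by (rule generator_norm_bound[OF _ BH]) (use 1 in auto)
      have "((\<lambda>t. e t * (\<Sum>y\<in>UNIV. of_real (\<mu> l t y) * ?d t y) -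
          of_real l * (e t * (\<Sum>y\<in>UNIV. of_real (\<pi> y) * G t y))) has_integral
          (J l - of_real l * (of_real T * D))) (cbox 0 T)"
        using has_integral_diff[OF bal[of l] has_integral_mult_right[OF S, of "of_real l"]] by simp
      then have "norm (J l - of_real l * (of_real T * D)) \<le> (\<bar>l\<bar> * (\<eta>' * (N * A))) * measure lborel (cbox 0 T)"
      proof (rule has_integral_bound[rotated])
        fix t assume "t \<in> cbox 0 T"
        then have t: "0 \<le> t" "t \<in> {0..T}" by auto
        \<comment> \<open>Two errors are separated: the rate remainder, already \<open>o(l)\<close>
          and weighted by a marginal at most 1, and the first-order term with
          \<open>\<mu> - \<pi>\<close>, which is \<open>l\<close> times \<open>o(1)\<close>. No rate
          of convergence of the marginals enters.\<close>
        let ?Z = "\<Sum>y\<in>UNIV. of_real (\<mu> l t y) * (?d t y - of_real l * G t y) +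
              of_real l * (of_real (\<mu> l t y - \<pi> y) * G t y)"
        let ?D = "e t * (\<Sum>y\<in>UNIV. of_real (\<mu> l t y) * ?d t y) - of_real l * (e t * (\<Sum>y\<in>UNIV. of_real (\<pi> y) * G t y))"
        have eq: "?D = e t * ?Z"
          unfolding sum_distrib_left sum_subtractf[symmetric]
          by (intro sum.cong refl) (simp add: algebra_simps)
        have "norm ?D = norm ?Z" unfolding eq by (simp only: norm_mult[of "e t"] norm_e mult_1_left)
        also have "\<dots> \<le> (\<Sum>y\<in>(UNIV::'a set). 1 * (N * ((\<bar>l\<bar> * \<eta>') * (2 * BH))) + \<bar>l\<bar> * (\<eta>' * BG))"
        proof (rule sum_norm_le)
          fix y
          have "0 \<le> \<mu> l t y" "\<mu> l t y \<le> 1"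
            unfolding \<mu>_def
            using bounded_transition.marginal_distribution(1)[OF pl[of l] \<pi>l'[of l] t(1), of y]
              bounded_transition.marginal_le_1[OF pl[of l] \<pi>l'[of l] t(1), of y] by simp_all
          then have "norm (of_real (\<mu> l t y) * (?d t y - of_real l * G t y)) \<le> 1 * (N * ((\<bar>l\<bar> * \<eta>') * (2 * BH)))"
            unfolding norm_mult norm_of_real by (intro mult_mono d) auto
          moreover have "norm (of_real l * (of_real (\<mu> l t y - \<pi> y) * G t y)) \<le> \<bar>l\<bar> * (\<eta>' * BG)"
            unfolding norm_mult norm_of_real
            by (intro mult_left_mono mult_mono BG 2[rule_format] t) (use \<eta>' in auto)
          ultimately show "norm (of_real (\<mu> l t y) * (?d t y - of_real l * G t y) +
              of_real l * (of_real (\<mu> l t y - \<pi> y) * G t y)) \<le>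
              1 * (N * ((\<bar>l\<bar> * \<eta>') * (2 * BH))) + \<bar>l\<bar> * (\<eta>' * BG)"
            by (rule order_trans[OF norm_triangle_ineq add_mono])
        qed
        also have "\<dots> = \<bar>l\<bar> * (\<eta>' * (N * A))"
          by (simp add: A_def N_def algebra_simps)
        finally show "norm (e t * (\<Sum>y\<in>UNIV. of_real (\<mu> l t y) * ?d t y) -
            of_real l * (e t * (\<Sum>y\<in>UNIV. of_real (\<pi> y) * G t y))) \<le> \<bar>l\<bar> * (\<eta>' * (N * A))" .
      qed (use \<eta>' N A in auto)
      also have "\<dots> = \<bar>l\<bar> * (\<eta>' * (N * A * T))" using T by simp
      also have "\<dots> \<le> \<bar>l\<bar> * (\<eta>' * (N * (A + 1) * T))"
        using \<eta>' N T by (intro mult_left_mono mult_right_mono) auto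
      also have "\<eta>' * (N * (A + 1) * T) = \<eta>" using N A T by (simp add: \<eta>'_def)
      finally show "norm (J l - of_real l * (of_real T * D)) \<le> \<bar>l\<bar> * \<eta>" .
    qed
  qed
  have "(\<Phi> has_vector_derivative D) (at 0)"
    unfolding has_vector_derivative_def has_derivative_at_alt
  proof (intro conjI allI impI)
    show "bounded_linear (\<lambda>x. x *\<^sub>R D)" by (rule bounded_linear_scaleR_left)
    fix \<eta> :: real assume "0 < \<eta>"
    \<comment> \<open>The factor \<open>T\<close> compensates the division by the period in the
      Fourier coefficient.\<close>
    then have "0 < \<eta> * T" using T by simp
    from main[OF this] obtain d where
      d: "0 < d" "\<And>l. l \<noteq> 0 \<Longrightarrow> \<bar>l\<bar> < d \<Longrightarrow> norm (J l - of_real l * (of_real T * D)) \<le> \<bar>l\<bar> * (\<eta> * T)"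
      by (auto simp: eventually_at)
    show "\<exists>d>0. \<forall>l. norm (l - 0) < d \<longrightarrow> norm (\<Phi> l - \<Phi> 0 - (l - 0) *\<^sub>R D) \<le> \<eta> * norm (l - 0)"
    proof (intro exI[of _ d] conjI allI impI d(1))
      fix l :: real assume l: "norm (l - 0) < d"
      show "norm (\<Phi> l - \<Phi> 0 - (l - 0) *\<^sub>R D) \<le> \<eta> * norm (l - 0)"
      proof (cases "l = 0")
        case False
        have "\<Phi> l - \<Phi> 0 - (l - 0) *\<^sub>R D = (J l - of_real l * (of_real T * D)) / of_real T"
          using T by (simp add: \<Phi>_diff scaleR_conv_of_real field_simps)
        then have "norm (\<Phi> l - \<Phi> 0 - (l - 0) *\<^sub>R D) = norm (J l - of_real l * (of_real T * D)) / T"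
          using T by (simp add: norm_divide)
        also have "\<dots> \<le> \<bar>l\<bar> * (\<eta> * T) / T"
          using d(2)[OF False] l T by (intro divide_right_mono) auto
        finally show ?thesis using T by (simp add: mult.commute)
      qed simp
    qed
  qed
  then show ?thesis unfolding \<Phi>_def D_def H_def \<mu>_def .
qed

end

section \<open>From path expectations to transition functions, and the response formula\<close>

theorem theorem4p7:
  fixes r :: "'a::finite \<Rightarrow> 'a \<Rightarrow> real"
    and g :: "real \<Rightarrow> 'a \<Rightarrow> 'a \<Rightarrow> real"
    and T :: real
    and p :: "real \<Rightarrow> real \<Rightarrow> 'a \<Rightarrow> 'a \<Rightarrow> real"
    and \<pi> :: "'a \<Rightarrow> real"
    and M :: "'w measure"
    and X :: "real \<Rightarrow> 'w \<Rightarrow> 'a"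
    and p\<^sub>l :: "real \<Rightarrow> real \<Rightarrow> real \<Rightarrow> 'a \<Rightarrow> 'a \<Rightarrow> real"
    and \<pi>\<^sub>l :: "real \<Rightarrow> 'a \<Rightarrow> real"
    and M\<^sub>l :: "real \<Rightarrow> 'v measure"
    and X\<^sub>l :: "real \<Rightarrow> real \<Rightarrow> 'v \<Rightarrow> 'a"
    and v :: "'a \<Rightarrow> real"
  assumes r_nonneg: "\<And>x y. 0 \<le> r x y"
    and r_diag: "\<And>x. r x x = 0"
    and r_irreducible: "irreducible_rates r"
    and p_transition: "transition_function (\<lambda>s. r) p"
    and \<pi>_invariant: "\<And>t. 0 \<le> t \<Longrightarrow> invariant_distribution (p 0 t) \<pi>"
    and X_process: "markov_jump_process M X \<pi> p"
    and T_pos: "0 < T"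
    and g_bounded: "\<exists>C. \<forall>s x y. \<bar>g s x y\<bar> \<le> C"
    and g_measurable: "\<And>x y. (\<lambda>s. g s x y) \<in> borel_measurable borel"
    and g_periodic: "\<And>s x y. g (s + T) x y = g s x y"
    and p\<^sub>l_transition: "\<And>l. transition_function (perturbed_rate g r l) (p\<^sub>l l)"
    and \<pi>\<^sub>l_invariant: "\<And>l. invariant_distribution (p\<^sub>l l 0 T) (\<pi>\<^sub>l l)"
    and X\<^sub>l_process: "\<And>l. markov_jump_process (M\<^sub>l l) (X\<^sub>l l) (\<pi>\<^sub>l l) (p\<^sub>l l)"
  defines "f \<equiv> \<lambda>l t. (\<integral>w. v (X\<^sub>l l t w) \<partial>M\<^sub>l l)"
    and "F \<equiv> \<lambda>(k::int) (s::real).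
       inner_L2 \<pi>
         (op_exp (\<lambda>h x. of_real s * (generator r h x + \<i> * of_int k * of_real (2 * pi / T) * h x))
            (\<lambda>x. of_real (v x)))
         (psi_hat \<pi> r g T k)"
    and "G \<equiv> \<lambda>(k::int) (s::real).
       exp (- \<i> * of_int k * of_real (2 * pi / T) * of_real s) *
         (\<integral>w. of_real (v (X s w)) * psi_hat \<pi> r g T k (X 0 w) \<partial>M)"
  shows "(\<forall>l. \<forall>t\<ge>0. f l (t + T) = f l t) \<and>
    (\<forall>k::int.
       set_integrable lborel {0..} (F k) \<and>
       set_integrable lborel {0..} (G k) \<and>
       ((\<lambda>l. fourier_coeff T k (\<lambda>t. of_real (f l t)))
          has_vector_derivative (LBINT s:{0..}. F k s)) (at 0) \<and>
       (LBINT s:{0..}. F k s) = (LBINT s:{0..}. G k s))"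
proof -
  have fin: "finite (range (\<lambda>(x, y). r x y))" by simp
  define K where "K = Max (range (\<lambda>(x, y). r x y))"
  have r_le: "r x y \<le> K" for x y
    unfolding K_def by (rule Max_ge[OF fin]) (auto intro: rev_image_eqI[of "(x, y)"])
  have r_abs: "\<bar>r x y\<bar> \<le> K" for x y using r_le r_nonneg[of x y] by simp
  interpret stationary_transition r p K \<pi>
    by standard (use p_transition r_abs r_nonneg r_irreducible \<pi>_invariant in auto)
  obtain C where g: "\<And>s x y. \<bar>g s x y\<bar> \<le> C" using g_bounded by blast
  have pl: "bounded_transition (perturbed_rate g r l) (p\<^sub>l l) (exp (\<bar>l\<bar> * C) * K)" for l
  proof
    show "transition_function (perturbed_rate g r l) (p\<^sub>l l)" by (rule p\<^sub>l_transition)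
    fix s x y
    have "l * g s x y \<le> \<bar>l\<bar> * \<bar>g s x y\<bar>" by (metis abs_ge_self abs_mult)
    also have "\<dots> \<le> \<bar>l\<bar> * C" by (intro mult_left_mono g) auto
    finally have "exp (l * g s x y) \<le> exp (\<bar>l\<bar> * C)" by simp
    then have "exp (l * g s x y) * \<bar>r x y\<bar> \<le> exp (\<bar>l\<bar> * C) * K"
      by (intro mult_mono r_abs) auto
    then show "\<bar>perturbed_rate g r l s x y\<bar> \<le> exp (\<bar>l\<bar> * C) * K"
      by (simp add: perturbed_rate_def abs_mult)
  qed
  define \<mu> where "\<mu> l t y = (\<Sum>x\<in>UNIV. \<pi>\<^sub>l l x * p\<^sub>l l 0 t x y)" for l t y
  have f_eq: "f l t = (\<Sum>y\<in>UNIV. \<mu> l t y * v y)" if "0 \<le> t" for l t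
  proof -
    have "f l t = (\<Sum>x\<in>UNIV. \<Sum>y\<in>UNIV. \<pi>\<^sub>l l x * p\<^sub>l l 0 t x y * v y)"
      unfolding f_def
      using markov_jump_process_expectation[where h = "\<lambda>x y. v y", OF X\<^sub>l_process that] by simp
    also have "\<dots> = (\<Sum>y\<in>UNIV. \<mu> l t y * v y)"
      by (subst sum.swap) (simp add: \<mu>_def sum_distrib_right)
    finally show ?thesis .
  qed
  have f_periodic: "f l (t + T) = f l t" if t: "0 \<le> t" for l t
  proof -
    have "perturbed_rate g r l (T + s) = perturbed_rate g r l s" for s
      using g_periodic[of s] by (simp add: perturbed_rate_def fun_eq_iff add.commute)
    from bounded_transition.periodic_marginal[OF pl this _ \<pi>\<^sub>l_invariant t, of 1]
    have "\<mu> l (t + T) y = \<mu> l t y" for y using T_pos by (simp add: \<mu>_def)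
    then show ?thesis using t T_pos by (simp add: f_eq)
  qed
  have response: "set_integrable lborel {0..} (F k) \<and> set_integrable lborel {0..} (G k) \<and>
       ((\<lambda>l. fourier_coeff T k (\<lambda>t. of_real (f l t)))
          has_vector_derivative (LBINT s:{0..}. F k s)) (at 0) \<and>
       (LBINT s:{0..}. F k s) = (LBINT s:{0..}. G k s)" for k
  proof -
    define c where "c = - \<i> * of_int k * of_real (2 * pi / T)"
    define vbar where "vbar = (\<Sum>x\<in>UNIV. complex_of_real (\<pi> x) * of_real (v x))"
    define h where "h y = complex_of_real (v y) - vbar" for y
    let ?\<psi> = "psi_hat \<pi> r g T k"
    have mean: "(\<Sum>x\<in>UNIV. of_real (\<pi> x) * h x) = 0"
    proof -
      have "(\<Sum>x\<in>UNIV. of_real (\<pi> x) * h x) = vbar - of_real (\<Sum>x\<in>UNIV. \<pi> x) * vbar"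
        unfolding h_def by (simp add: right_diff_distrib sum_subtractf vbar_def sum_distrib_right)
      then show ?thesis by (simp add: \<pi>_sum)
    qed
    have \<psi>_mean: "(\<Sum>y\<in>UNIV. of_real (\<pi> y) * ?\<psi> y) = 0"
      by (rule psi_hat_mean[OF T_pos g g_measurable])
    \<comment> \<open>The common value of both response integrands for \<open>s \<ge> 0\<close>,
      written with the centred \<open>h\<close>. This form is integrable and matches the computed
      derivative; \<open>W_eq\<close> passes to the original \<open>v\<close> through the zero mean
      of \<open>psi_hat\<close>.\<close>
    define W where "W s = (\<Sum>y\<in>UNIV. of_real (\<pi> y) * ?\<psi> y * gen_exp r c s h y)" for s
    have W_eq: "W s = exp (of_real s * c) * (\<Sum>y\<in>UNIV. of_real (\<pi> y) * ?\<psi> y * P s (\<lambda>y. of_real (v y)) y)"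
      if s: "0 \<le> s" for s
    proof -
      have "W s = exp (of_real s * c) * (\<Sum>y\<in>UNIV. of_real (\<pi> y) * ?\<psi> y * (P s (\<lambda>y. of_real (v y)) y - vbar))"
        unfolding W_def h_def[abs_def] gen_exp_eq_P[OF s] P_shift_const[OF s] sum_distrib_left
        by (simp only: mult_ac)
      also have "(\<Sum>y\<in>UNIV. of_real (\<pi> y) * ?\<psi> y * (P s (\<lambda>y. of_real (v y)) y - vbar)) =
          (\<Sum>y\<in>UNIV. of_real (\<pi> y) * ?\<psi> y * P s (\<lambda>y. of_real (v y)) y) - (\<Sum>y\<in>UNIV. of_real (\<pi> y) * ?\<psi> y) * vbar"
        by (simp add: right_diff_distrib sum_subtractf sum_distrib_right)
      finally show ?thesis using \<psi>_mean by simp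
    qed
    have G_eq: "G k s = W s" if s: "0 \<le> s" for s
    proof -
      have "(\<integral>w. of_real (v (X s w)) * ?\<psi> (X 0 w) \<partial>M) =
          (\<Sum>x\<in>UNIV. \<Sum>y\<in>UNIV. (\<pi> x * p 0 s x y) *\<^sub>R (of_real (v y) * ?\<psi> x))"
        by (rule markov_jump_process_expectation[OF X_process s])
      also have "\<dots> = (\<Sum>y\<in>UNIV. of_real (\<pi> y) * ?\<psi> y * P s (\<lambda>y. of_real (v y)) y)"
        unfolding P_def sum_distrib_left by (simp add: scaleR_conv_of_real mult_ac)
      finally show ?thesis
        unfolding W_eq[OF s] G_def c_def by (simp only: mult.commute)
    qed
    have F_eq: "F k s = W s" if s: "0 \<le> s" for s
    proof -
      \<comment> \<open>The kernel and \<open>v\<close> are real, so conjugation affects only the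
        exponential factor and turns \<open>\<i>k\<omega>\<close> into \<open>c\<close>.\<close>
      have "cnj (gen_exp r (\<i> * of_int k * of_real (2 * pi / T)) s (\<lambda>x. of_real (v x)) x) =
          exp (of_real s * c) * P s (\<lambda>y. of_real (v y)) x" for x
      proof -
        have "cnj (P s (\<lambda>y. of_real (v y)) x) = P s (\<lambda>y. of_real (v y)) x" by (simp add: P_def)
        then show ?thesis by (simp add: gen_exp_eq_P[OF s] c_def exp_cnj)
      qed
      then have "F k s = (\<Sum>x\<in>UNIV. of_real (\<pi> x) * (exp (of_real s * c) * P s (\<lambda>y. of_real (v y)) x) * ?\<psi> x)"
        unfolding F_def inner_L2_def gen_exp_def[symmetric] by simp
      then show ?thesis unfolding W_eq[OF s] sum_distrib_left by (simp only: mult_ac)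
    qed
    have int: "set_integrable lborel {0..} (\<lambda>s. gen_exp r c s h y)" for y
      by (rule gen_exp_integrable[OF mean]) (simp add: c_def)
    have W_int: "set_integrable lborel {0..} W"
      unfolding W_def by (intro set_integral_sum(1) set_integrable_mult_right int)
    have W_value: "(LBINT s:{0..}. W s) = (\<Sum>y\<in>UNIV. of_real (\<pi> y) * ?\<psi> y * (LBINT s:{0..}. gen_exp r c s h y))"
      unfolding W_def by (subst set_integral_sum(2)) (auto intro: int)
    have F_int: "(LBINT s:{0..}. F k s) = (LBINT s:{0..}. W s)" and G_int: "(LBINT s:{0..}. G k s) = (LBINT s:{0..}. W s)"
      by (auto intro!: set_lebesgue_integral_cong simp: F_eq G_eq)
    have "set_integrable lborel {0..} (F k) = set_integrable lborel {0..} W"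
      "set_integrable lborel {0..} (G k) = set_integrable lborel {0..} W"
      by (intro set_integrable_cong refl; simp add: F_eq G_eq)+
    moreover have "((\<lambda>l. fourier_coeff T k (\<lambda>t. of_real (f l t))) has_vector_derivative (LBINT s:{0..}. W s)) (at 0)"
    proof -
      \<comment> \<open>Only times in \<open>{0..T}\<close> enter the coefficient, where
        \<open>f_eq\<close> applies.\<close>
      have "fourier_coeff T k (\<lambda>t. of_real (f l t)) = fourier_coeff T k (\<lambda>t. of_real (\<Sum>y\<in>UNIV. \<mu> l t y * v y))" for l
        unfolding fourier_coeff_def
        by (intro arg_cong[where f = "\<lambda>x. 1 / of_real T * x"] set_lebesgue_integral_cong) (auto simp: f_eq)
      then show ?thesis
        using response_derivative[where k = k and v = v, OF T_pos g g_measurable g_periodic pl \<pi>\<^sub>l_invariant]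
        unfolding W_value h_def[abs_def] vbar_def c_def \<mu>_def by simp
    qed
    ultimately show ?thesis using F_int G_int W_int by simp
  qed
  show ?thesis using f_periodic response by blast
qed

end
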